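(* Suppose $x=(u_0,u_1,\dots,u_\ell,\operatorname{vec}(V_1),\dots,\operatorname{vec}(V_\ell))$ satisfies $$\mathbf{e}_i^T(W_ku_k+b_ku_0)\ne0,\qquad \mathbf{e}_i^TW_kV_k\ne0\qquad\text{(NPCQ)}$$ for all $k\in\{1,\dots,\ell-1\}$ and $i\in\{1,\dots,n_{k+1}\}$. Then $x$ is first-order optimal for (BM-$r$) if and only if there exist dual multipliers $y$ and $z$ that certify $x$ as being first-order optimal. Moreover, the choice of dual multipliers $y,z$ is unique.
   Context: Data: $\ell\ge 2$; layer sizes $n_1,\dots,n_\ell$ with $n=\sum_{k=1}^\ell n_k$; $W_k\in\mathbb{R}^{n_{k+1}\times n_k}$ and $b_k\in\mathbb{R}^{n_{k+1}}$ for $k=1,\dots,\ell-1$; $w_\ell\in\mathbb{R}^{n_\ell}$; $\hat x\in\mathbb{R}^{n_1}$; radius $\rho$; bound $R>0$; rank $r\ge1$. $\|\cdot\|$ is the Euclidean (Frobenius) norm; vector inequalities are componentwise; $\mathbf{e}_i$ is the $i$-th canonical basis vector; $\odot$ is the elementwise product. Problem (BM-$r$): variables $u_0\in\mathbb{R}$, $u_k\in\mathbb{R}^{n_k}$, $V_k\in\mathbb{R}^{n_k\times(r-1)}$, $k=1,\dots,\ell$, collected in $x=(u_0,\{u_k\}_{k=1}^\ell,\{\operatorname{vec}(V_k)\}_{k=1}^\ell)$. It is the nonlinear program $\min_{\|x\|\le R}f(x)$ s.t. $g(x)\le0$, $h(x)=0$, with $f(x)=u_0\,(w_\ell^Tu_\ell)$,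 and with $g=(g_0,\{g_{k,1},g_{k,2}\}_{k=1}^{\ell-1})$ and $h=(h_0,\{h_k\}_{k=1}^{\ell-1})$ given by $g_0(x)=\|u_1-u_0\hat x\|^2+\|V_1\|^2-\rho^2$, $g_{k,1}(x)=-u_0u_{k+1}$, $g_{k,2}(x)=u_0(W_ku_k+b_ku_0-u_{k+1})$, $h_0(x)=1-u_0^2$, $h_k(x)=\operatorname{diag}[(u_{k+1}-W_ku_k-b_ku_0)u_{k+1}^T+(V_{k+1}-W_kV_k)V_{k+1}^T]$. The corresponding multipliers are $y=(y_0,\{y_{k,1},y_{k,2}\}_{k=1}^{\ell-1})$ and $z=(z_0,\{z_k\}_{k=1}^{\ell-1})$. The matrices $\nabla g(x),\nabla h(x)$ have the gradients of the components as columns. First-order optimality: $x$ is first-order optimal if $g(x)\le0$, $h(x)=0$ and there is no escape path, i.e. no continuously differentiable path $x(t)$ with $x(0)=x$ such that, for some $\delta>0$ and $\epsilon>0$, $f(x(t))\le f(x)-\delta t$, $g(x(t))\le0$, $h(x(t))=0$ for all $t\in[0,\epsilon)$. Multipliers $y,z$ certify (the feasible point) $x$ as first-order optimal if $\nabla f(x)+\nabla g(x)y+\nabla h(x)z=0$, $y\odot g(x)=0$, $y\ge0$. *)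

theory Defs
  imports "HOL-Analysis.Analysis" "Jordan_Normal_Form.Matrix"
begin

hide_type (open) Finite_Cartesian_Product.vec
hide_const (open) Finite_Cartesian_Product.vec Finite_Cartesian_Product.vec_lambda
  Finite_Cartesian_Product.row Finite_Cartesian_Product.mat
no_notation vec_nth (infixl \<open>$\<close> 90)
unbundle no inner_syntax

text \<open>Layers are numbered \<open>1,\<dots>,\<ell>\<close> as in the problem statement, whereas entries of vectors
  and matrices are numbered from 0. The fields \<open>weight k\<close> and \<open>bias k\<close> (\<open>1 \<le> k < \<ell>\<close>) are the
  matrix \<open>W\<^sub>k\<close> and the vector \<open>b\<^sub>k\<close> from layer \<open>k\<close> to layer \<open>k + 1\<close>; \<open>out_weight\<close> is \<open>w\<^sub>\<ell>\<close>,
  \<open>centre\<close> is the point written \<open>x\<close>-hat, \<open>bound\<close> is \<open>R\<close> and \<open>frank\<close> is the factorization rank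
  \<open>r\<close>. The bound \<open>\<parallel>x\<parallel> \<le> R\<close> only makes the domain of the program compact; first-order optimality
  and the multipliers refer to \<open>g\<close> and \<open>h\<close> only.\<close>

record bm_data =
  depth :: nat
  width :: "nat \<Rightarrow> nat"
  weight :: "nat \<Rightarrow> real mat"
  bias :: "nat \<Rightarrow> real vec"
  out_weight :: "real vec"
  centre :: "real vec"
  radius :: real
  bound :: real
  frank :: nat

definition bm_wf :: "bm_data \<Rightarrow> bool" where
  "bm_wf D \<longleftrightarrow>
     2 \<le> depth D \<and> 1 \<le> frank D \<and> 0 < bound D \<and>
     (\<forall>k\<in>{1..depth D}. 1 \<le> width D k) \<and>
     (\<forall>k\<in>{1..<depth D}. weight D k \<in> carrier_mat (width D (k + 1)) (width D k) \<and>
                        bias D k \<in> carrier_vec (width D (k + 1))) \<and>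
     out_weight D \<in> carrier_vec (width D (depth D)) \<and>
     centre D \<in> carrier_vec (width D 1)"

text \<open>The decision variable \<open>x = (u\<^sub>0, {u\<^sub>k}, {vec V\<^sub>k})\<close> lives in a Euclidean space whose dimension
  depends on the data. It is a function from scalar coordinates to the reals, of which only
  the values on the finite set \<open>coords D\<close> matter.\<close>

datatype coord = Cu0 | Cu nat nat | CV nat nat nat

type_synonym point = "coord \<Rightarrow> real"

definition coords :: "bm_data \<Rightarrow> coord set" where
  "coords D = {Cu0}
     \<union> {Cu k i | k i. k \<in> {1..depth D} \<and> i < width D k}
     \<union> {CV k i j | k i j. k \<in> {1..depth D} \<and> i < width D k \<and> j < frank D - 1}"

definition u0 :: "point \<Rightarrow> real" where
  "u0 x = x Cu0"

definition uvec :: "bm_data \<Rightarrow> point \<Rightarrow> nat \<Rightarrow> real vec" where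
  "uvec D x k = vec (width D k) (\<lambda>i. x (Cu k i))"

definition Vmat :: "bm_data \<Rightarrow> point \<Rightarrow> nat \<Rightarrow> real mat" where
  "Vmat D x k = mat (width D k) (frank D - 1) (\<lambda>(i, j). x (CV k i j))"

definition vec_norm2 :: "real vec \<Rightarrow> real" where
  "vec_norm2 v = L2_set (\<lambda>i. v $ i) {..<dim_vec v}"

definition frobenius_norm :: "real mat \<Rightarrow> real" where
  "frobenius_norm A = L2_set (\<lambda>ij. A $$ ij) ({..<dim_row A} \<times> {..<dim_col A})"

definition outer_prod :: "real vec \<Rightarrow> real vec \<Rightarrow> real mat" where
  "outer_prod v w = mat (dim_vec v) (dim_vec w) (\<lambda>(i, j). v $ i * w $ j)"

definition obj :: "bm_data \<Rightarrow> point \<Rightarrow> real" where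
  "obj D x = u0 x * (out_weight D \<bullet> uvec D x (depth D))"

definition g0 :: "bm_data \<Rightarrow> point \<Rightarrow> real" where
  "g0 D x = (vec_norm2 (uvec D x 1 - u0 x \<cdot>\<^sub>v centre D))\<^sup>2 + (frobenius_norm (Vmat D x 1))\<^sup>2
            - (radius D)\<^sup>2"

definition g1 :: "bm_data \<Rightarrow> nat \<Rightarrow> point \<Rightarrow> real vec" where
  "g1 D k x = - (u0 x \<cdot>\<^sub>v uvec D x (k + 1))"

definition g2 :: "bm_data \<Rightarrow> nat \<Rightarrow> point \<Rightarrow> real vec" where
  "g2 D k x = u0 x \<cdot>\<^sub>v (weight D k *\<^sub>v uvec D x k + u0 x \<cdot>\<^sub>v bias D k - uvec D x (k + 1))"

definition h0 :: "point \<Rightarrow> real" where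
  "h0 x = 1 - (u0 x)\<^sup>2"

definition hmat :: "bm_data \<Rightarrow> nat \<Rightarrow> point \<Rightarrow> real mat" where
  "hmat D k x =
     outer_prod (uvec D x (k + 1) - weight D k *\<^sub>v uvec D x k - u0 x \<cdot>\<^sub>v bias D k) (uvec D x (k + 1))
     + (Vmat D x (k + 1) - weight D k * Vmat D x k) * transpose_mat (Vmat D x (k + 1))"

text \<open>\<open>G1 k i\<close>, \<open>G2 k i\<close> and \<open>H k i\<close> name entry \<open>i\<close> of the vector constraints
  \<open>g\<^sub>k\<^sub>,\<^sub>1 \<le> 0\<close>, \<open>g\<^sub>k\<^sub>,\<^sub>2 \<le> 0\<close> and \<open>h\<^sub>k = 0\<close>.\<close>

datatype ineq_idx = G0 | G1 nat nat | G2 nat nat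

datatype eq_idx = H0 | H nat nat

definition ineqs :: "bm_data \<Rightarrow> ineq_idx set" where
  "ineqs D = {G0}
     \<union> {G1 k i | k i. k \<in> {1..<depth D} \<and> i < width D (k + 1)}
     \<union> {G2 k i | k i. k \<in> {1..<depth D} \<and> i < width D (k + 1)}"

definition eqs :: "bm_data \<Rightarrow> eq_idx set" where
  "eqs D = {H0} \<union> {H k i | k i. k \<in> {1..<depth D} \<and> i < width D (k + 1)}"

fun gcon :: "bm_data \<Rightarrow> ineq_idx \<Rightarrow> point \<Rightarrow> real" where
  "gcon D G0 x = g0 D x"
| "gcon D (G1 k i) x = g1 D k x $ i"
| "gcon D (G2 k i) x = g2 D k x $ i"

fun hcon :: "bm_data \<Rightarrow> eq_idx \<Rightarrow> point \<Rightarrow> real" where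
  "hcon D H0 x = h0 x"
| "hcon D (H k i) x = hmat D k x $$ (i, i)"

definition bm_feasible :: "bm_data \<Rightarrow> point \<Rightarrow> bool" where
  "bm_feasible D x \<longleftrightarrow> (\<forall>c\<in>ineqs D. gcon D c x \<le> 0) \<and> (\<forall>c\<in>eqs D. hcon D c x = 0)"

text \<open>A path is continuously differentiable on \<open>[0, \<epsilon>)\<close> if every coordinate is, with a one-sided
  derivative at 0.\<close>

definition C1_path :: "bm_data \<Rightarrow> real \<Rightarrow> (real \<Rightarrow> point) \<Rightarrow> bool" where
  "C1_path D \<epsilon> p \<longleftrightarrow>
     (\<forall>c\<in>coords D. \<exists>p'. continuous_on {0..<\<epsilon>} p' \<and>
        (\<forall>t\<in>{0..<\<epsilon>}. ((\<lambda>s. p s c) has_real_derivative p' t) (at t within {0..<\<epsilon>})))"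

definition escape_path :: "bm_data \<Rightarrow> point \<Rightarrow> (real \<Rightarrow> point) \<Rightarrow> bool" where
  "escape_path D x p \<longleftrightarrow>
     (\<forall>c\<in>coords D. p 0 c = x c) \<and>
     (\<exists>\<delta>>0. \<exists>\<epsilon>>0. C1_path D \<epsilon> p \<and>
        (\<forall>t\<in>{0..<\<epsilon>}. obj D (p t) \<le> obj D x - \<delta> * t \<and> bm_feasible D (p t)))"

definition first_order_optimal :: "bm_data \<Rightarrow> point \<Rightarrow> bool" where
  "first_order_optimal D x \<longleftrightarrow> bm_feasible D x \<and> \<not> (\<exists>p. escape_path D x p)"

definition grad :: "(point \<Rightarrow> real) \<Rightarrow> point \<Rightarrow> coord \<Rightarrow> real" where
  "grad F x c = deriv (\<lambda>s. F (x(c := s))) (x c)"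

definition certifies :: "bm_data \<Rightarrow> point \<Rightarrow> (ineq_idx \<Rightarrow> real) \<Rightarrow> (eq_idx \<Rightarrow> real) \<Rightarrow> bool" where
  "certifies D x y z \<longleftrightarrow>
     bm_feasible D x \<and>
     (\<forall>c\<in>coords D. grad (obj D) x c + (\<Sum>a\<in>ineqs D. grad (gcon D a) x c * y a)
                                    + (\<Sum>a\<in>eqs D. grad (hcon D a) x c * z a) = 0) \<and>
     (\<forall>a\<in>ineqs D. y a * gcon D a x = 0) \<and>
     (\<forall>a\<in>ineqs D. 0 \<le> y a)"

definition NPCQ :: "bm_data \<Rightarrow> point \<Rightarrow> bool" where
  "NPCQ D x \<longleftrightarrow>
     (\<forall>k\<in>{1..<depth D}. \<forall>i<width D (k + 1).
        (weight D k *\<^sub>v uvec D x k + u0 x \<cdot>\<^sub>v bias D k) $ i \<noteq> 0 \<and>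
        row (weight D k * Vmat D x k) i \<noteq> 0\<^sub>v (frank D - 1))"

end

theory Submission
  imports Defs
begin

text \<open>At a feasible point the constraint \<open>h\<^sub>k = 0\<close> puts the output
  \<open>(s, q) = (e\<^sub>i\<^sup>T u\<^sub>k\<^sub>+\<^sub>1, e\<^sub>i\<^sup>T V\<^sub>k\<^sub>+\<^sub>1)\<close> of each neuron on the sphere with
  diameter from \<open>0\<close> to \<open>(a, v) = (e\<^sub>i\<^sup>T (W\<^sub>k u\<^sub>k + b\<^sub>k u\<^sub>0), e\<^sub>i\<^sup>T W\<^sub>k V\<^sub>k)\<close>.
  Nondegeneracy \<open>a \<noteq> 0\<close>, \<open>v \<noteq> 0\<close> makes the active constraints of the neuron independent in
  \<open>(s, q)\<close>: at most one of \<open>s = 0\<close>, \<open>s = a\<close> is active, and then the \<open>q\<close>-part \<open>2 q - v\<close> of the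
  normal of the sphere has norm \<open>\<parallel>v\<parallel>\<close>. As layer \<open>k + 1\<close> only enters the constraints of layers
  \<open>\<ge> k\<close>, a forward sweep shows that the linearized active constraints are surjective, which gives
  uniqueness of the multipliers and, if they do not exist, a direction that strictly decreases the
  objective and the active inequalities. Such a direction is turned into a path without the implicit
  function theorem: move along a straight line and, layer by layer, project each neuron radially
  onto its moving sphere.\<close>

section \<open>Differentiability in coordinates and the chain rule\<close>

text \<open>Differentiability is encoded by the chain rule along curves, since \<open>point\<close>
  is a bare function space in which only the coordinates in \<open>coords D\<close> count. The free
  set \<open>S\<close> admits the one-sided derivative of a path at 0.\<close>

definition gradient_at :: "bm_data \<Rightarrow> (point \<Rightarrow> real) \<Rightarrow> point \<Rightarrow> (coord \<Rightarrow> real) \<Rightarrow> bool" where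
  "gradient_at D F x G \<longleftrightarrow>
     (\<forall>p d t S. (\<forall>c\<in>coords D. p t c = x c) \<longrightarrow>
        (\<forall>c\<in>coords D. ((\<lambda>s. p s c) has_real_derivative d c) (at t within S)) \<longrightarrow>
        ((\<lambda>s. F (p s)) has_real_derivative (\<Sum>c\<in>coords D. G c * d c)) (at t within S))"

text \<open>An escape path agrees with \<open>x\<close> at time 0 on \<open>coords D\<close> only,
  so the values must not depend on any other coordinate.\<close>

definition smooth_fun :: "bm_data \<Rightarrow> (point \<Rightarrow> real) \<Rightarrow> bool" where
  "smooth_fun D F \<longleftrightarrow>
     (\<forall>x y. (\<forall>c\<in>coords D. x c = y c) \<longrightarrow> F x = F y) \<and> (\<forall>x. \<exists>G. gradient_at D F x G)"

text \<open>Built from the same partial derivatives as \<open>certifies\<close>;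
  \<open>chain_rule\<close> identifies it with the derivative along any curve of velocity
  \<open>d\<close>.\<close>

definition dirder :: "bm_data \<Rightarrow> (point \<Rightarrow> real) \<Rightarrow> point \<Rightarrow> point \<Rightarrow> real" where
  "dirder D F x d = (\<Sum>c\<in>coords D. grad F x c * d c)"

lemma finite_coords [simp]: "finite (coords D)"
proof -
  have "{Cu k i | k i. k \<in> {1..depth D} \<and> i < width D k}
      = (\<lambda>(k, i). Cu k i) ` (SIGMA k:{1..depth D}. {..<width D k})"
    by (auto simp: image_iff)
  moreover have "{CV k i j | k i j. k \<in> {1..depth D} \<and> i < width D k \<and> j < frank D - 1}
      = (\<lambda>(k, i, j). CV k i j) ` (SIGMA k:{1..depth D}. {..<width D k} \<times> {..<frank D - 1})"
    by (auto simp: image_iff)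
  ultimately show ?thesis
    by (simp add: coords_def)
qed

lemma coords_iff [simp]:
  "Cu0 \<in> coords D"
  "Cu k i \<in> coords D \<longleftrightarrow> 1 \<le> k \<and> k \<le> depth D \<and> i < width D k"
  "CV k i j \<in> coords D \<longleftrightarrow> 1 \<le> k \<and> k \<le> depth D \<and> i < width D k \<and> j < frank D - 1"
  by (auto simp: coords_def)

lemma finite_ineqs [simp]: "finite (ineqs D)"
proof -
  have "{G1 k i | k i. k \<in> {1..<depth D} \<and> i < width D (k + 1)}
      = (\<lambda>(k, i). G1 k i) ` (SIGMA k:{1..<depth D}. {..<width D (k + 1)})"
    and "{G2 k i | k i. k \<in> {1..<depth D} \<and> i < width D (k + 1)}
      = (\<lambda>(k, i). G2 k i) ` (SIGMA k:{1..<depth D}. {..<width D (k + 1)})"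
    by (auto simp: image_iff)
  then show ?thesis
    by (simp add: ineqs_def)
qed

lemma ineqs_iff [simp]:
  "G0 \<in> ineqs D"
  "G1 k i \<in> ineqs D \<longleftrightarrow> 1 \<le> k \<and> k < depth D \<and> i < width D (k + 1)"
  "G2 k i \<in> ineqs D \<longleftrightarrow> 1 \<le> k \<and> k < depth D \<and> i < width D (k + 1)"
  by (auto simp: ineqs_def)

lemma finite_eqs [simp]: "finite (eqs D)"
proof -
  have "{H k i | k i. k \<in> {1..<depth D} \<and> i < width D (k + 1)}
      = (\<lambda>(k, i). H k i) ` (SIGMA k:{1..<depth D}. {..<width D (k + 1)})"
    by (auto simp: image_iff)
  then show ?thesis
    by (simp add: eqs_def)
qed

lemma eqs_iff [simp]:
  "H0 \<in> eqs D"
  "H k i \<in> eqs D \<longleftrightarrow> 1 \<le> k \<and> k < depth D \<and> i < width D (k + 1)"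
  by (auto simp: eqs_def)

lemma gradient_atI:
  assumes "\<And>p d t S. (\<And>c. c \<in> coords D \<Longrightarrow> p t c = x c) \<Longrightarrow>
      (\<And>c. c \<in> coords D \<Longrightarrow> ((\<lambda>s. p s c) has_real_derivative d c) (at t within S)) \<Longrightarrow>
      ((\<lambda>s. F (p s)) has_real_derivative (\<Sum>c\<in>coords D. G c * d c)) (at t within S)"
  shows "gradient_at D F x G"
  unfolding gradient_at_def
proof (intro allI impI, goal_cases)
  case (1 p d t S)
  then show ?case
    by (intro assms) auto
qed

lemma gradient_atD:
  assumes "gradient_at D F x G" "\<And>c. c \<in> coords D \<Longrightarrow> p t c = x c"
    "\<And>c. c \<in> coords D \<Longrightarrow> ((\<lambda>s. p s c) has_real_derivative d c) (at t within S)"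
  shows "((\<lambda>s. F (p s)) has_real_derivative (\<Sum>c\<in>coords D. G c * d c)) (at t within S)"
  using assms(1)[unfolded gradient_at_def, rule_format, of p t d S] assms(2,3) by simp

lemma smooth_funI:
  assumes "\<And>x y. (\<And>c. c \<in> coords D \<Longrightarrow> x c = y c) \<Longrightarrow> F x = F y"
    and "\<And>x. \<exists>G. gradient_at D F x G"
  shows "smooth_fun D F"
  unfolding smooth_fun_def using assms by blast

lemma smooth_fun_cong:
  assumes "smooth_fun D F" "\<And>c. c \<in> coords D \<Longrightarrow> x c = y c"
  shows "F x = F y"
  using assms unfolding smooth_fun_def by blast

lemma smooth_fun_gradient: "smooth_fun D F \<Longrightarrow> \<exists>G. gradient_at D F x G"
  unfolding smooth_fun_def by blast

lemma smooth_fun_const: "smooth_fun D (\<lambda>x. a)"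
proof (rule smooth_funI)
  show "\<exists>G. gradient_at D (\<lambda>x. a) x G" for x
    by (intro exI[of _ "\<lambda>_. 0"] gradient_atI) simp
qed simp

lemma smooth_fun_coord:
  assumes "c \<in> coords D"
  shows "smooth_fun D (\<lambda>x. x c)"
proof (rule smooth_funI)
  have "(\<Sum>b\<in>coords D. (if b = c then 1 else 0) * d b) = d c" for d :: point
    using assms by (simp add: if_distrib[of "\<lambda>a. a * _"] cong: if_cong)
  then show "\<exists>G. gradient_at D (\<lambda>x. x c) x G" for x
    using assms by (intro exI[of _ "\<lambda>b. if b = c then 1 else 0"] gradient_atI) simp
qed (use assms in auto)

lemma smooth_fun_add:
  assumes "smooth_fun D F" "smooth_fun D F'"
  shows "smooth_fun D (\<lambda>x. F x + F' x)"
proof (rule smooth_funI)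
  fix x y :: point
  assume eq: "\<And>c. c \<in> coords D \<Longrightarrow> x c = y c"
  show "F x + F' x = F y + F' y"
    using smooth_fun_cong[OF assms(1) eq] smooth_fun_cong[OF assms(2) eq] by simp
next
  fix x
  obtain G G' where G: "gradient_at D F x G" "gradient_at D F' x G'"
    using assms smooth_fun_gradient by meson
  show "\<exists>G. gradient_at D (\<lambda>x. F x + F' x) x G"
  proof (intro exI gradient_atI)
    fix p d t S
    assume "\<And>c. c \<in> coords D \<Longrightarrow> p t c = x c"
      "\<And>c. c \<in> coords D \<Longrightarrow> ((\<lambda>s. p s c) has_real_derivative d c) (at t within S)"
    from DERIV_add[OF G[THEN gradient_atD, OF this]]
    show "((\<lambda>s. F (p s) + F' (p s)) has_real_derivative
        (\<Sum>c\<in>coords D. (G c + G' c) * d c)) (at t within S)"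
      by (simp add: sum.distrib distrib_right)
  qed
qed

lemma smooth_fun_mult:
  assumes "smooth_fun D F" "smooth_fun D F'"
  shows "smooth_fun D (\<lambda>x. F x * F' x)"
proof (rule smooth_funI)
  fix x y :: point
  assume eq: "\<And>c. c \<in> coords D \<Longrightarrow> x c = y c"
  show "F x * F' x = F y * F' y"
    using smooth_fun_cong[OF assms(1) eq] smooth_fun_cong[OF assms(2) eq] by simp
next
  fix x
  obtain G G' where G: "gradient_at D F x G" "gradient_at D F' x G'"
    using assms smooth_fun_gradient by meson
  show "\<exists>G. gradient_at D (\<lambda>x. F x * F' x) x G"
  proof (intro exI gradient_atI)
    fix p d t S
    assume p: "\<And>c. c \<in> coords D \<Longrightarrow> p t c = x c"
      "\<And>c. c \<in> coords D \<Longrightarrow> ((\<lambda>s. p s c) has_real_derivative d c) (at t within S)"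
    have "F (p t) = F x" "F' (p t) = F' x"
      using smooth_fun_cong[OF assms(1) p(1)] smooth_fun_cong[OF assms(2) p(1)] by simp_all
    with DERIV_mult[OF G[THEN gradient_atD, OF p]]
    show "((\<lambda>s. F (p s) * F' (p s)) has_real_derivative
        (\<Sum>c\<in>coords D. (G c * F' x + F x * G' c) * d c)) (at t within S)"
      by (simp add: sum.distrib sum_distrib_left algebra_simps)
  qed
qed

lemma smooth_fun_diff:
  assumes "smooth_fun D F" "smooth_fun D F'"
  shows "smooth_fun D (\<lambda>x. F x - F' x)"
  using smooth_fun_add[OF assms(1) smooth_fun_mult[OF smooth_fun_const[of D "-1"] assms(2)]]
  by simp

lemma smooth_fun_power2: "smooth_fun D F \<Longrightarrow> smooth_fun D (\<lambda>x. (F x)\<^sup>2)"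
  unfolding power2_eq_square by (rule smooth_fun_mult)

lemma smooth_fun_sum:
  assumes "\<And>i. i \<in> I \<Longrightarrow> smooth_fun D (F i)"
  shows "smooth_fun D (\<lambda>x. \<Sum>i\<in>I. F i x)"
proof (cases "finite I")
  case True
  then show ?thesis
    using assms
  proof (induction I)
    case (insert i I)
    then have "smooth_fun D (\<lambda>x. F i x + (\<Sum>i\<in>I. F i x))"
      by (intro smooth_fun_add) auto
    with insert.hyps show ?case
      by simp
  qed (simp add: smooth_fun_const)
qed (simp add: smooth_fun_const)

lemmas smooth_fun_intros = smooth_fun_const smooth_fun_add smooth_fun_mult smooth_fun_diff
  smooth_fun_power2 smooth_fun_sum smooth_fun_coord

text \<open>Moving one coordinate alone is a curve too, and along it the derivative is a single
  entry of \<open>G\<close>. Hence the gradient promised by \<open>smooth_fun\<close> consists of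
  the partial derivatives \<open>grad\<close>.\<close>

lemma chain_rule:
  assumes F: "smooth_fun D F"
    and p: "\<And>c. c \<in> coords D \<Longrightarrow> p t c = x c"
      "\<And>c. c \<in> coords D \<Longrightarrow> ((\<lambda>s. p s c) has_real_derivative d c) (at t within S)"
  shows "((\<lambda>s. F (p s)) has_real_derivative dirder D F x d) (at t within S)"
proof -
  obtain G where G: "gradient_at D F x G"
    using F smooth_fun_gradient by blast
  have "grad F x c = G c" if "c \<in> coords D" for c
  proof -
    have "((\<lambda>s. F (x(c := s))) has_real_derivative
            (\<Sum>b\<in>coords D. G b * (if b = c then 1 else 0))) (at (x c))"
      by (rule gradient_atD[OF G]) (auto intro!: derivative_eq_intros)
    then show ?thesis
      using that by (simp add: grad_def DERIV_imp_deriv if_distrib[of "\<lambda>a. _ * a"] cong: if_cong)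
  qed
  then have "dirder D F x d = (\<Sum>c\<in>coords D. G c * d c)"
    by (simp add: dirder_def)
  then show ?thesis
    using gradient_atD[OF G p] by simp
qed

text \<open>Reduces a pairing with the gradient to a one-variable derivative along a straight line;
  the formulas \<open>dirder_g0\<close> to \<open>dirder_h\<close> come from it.\<close>

lemma dirder_eqI:
  assumes "smooth_fun D F"
    and "((\<lambda>t. F (\<lambda>c. x c + t * d c)) has_real_derivative L) (at 0)"
  shows "dirder D F x d = L"
proof -
  have "((\<lambda>t. F (\<lambda>c. x c + t * d c)) has_real_derivative dirder D F x d) (at 0)"
    by (rule chain_rule[OF assms(1)]) (auto intro!: derivative_eq_intros)
  then show ?thesis
    using assms(2) DERIV_unique by blast
qed

section \<open>The constraints as polynomials in the coordinates\<close>

text \<open>Entry \<open>i\<close> of \<open>W\<^sub>k u\<^sub>k + b\<^sub>k u\<^sub>0\<close>. With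
  the bias multiplied by \<open>u\<^sub>0\<close> it is linear in the point, not merely affine, so
  it applies to directions as well (\<open>pre_add_scaled\<close>).\<close>

definition pre_u :: "bm_data \<Rightarrow> nat \<Rightarrow> nat \<Rightarrow> point \<Rightarrow> real" where
  "pre_u D k i x = (\<Sum>j<width D k. weight D k $$ (i, j) * x (Cu k j)) + x Cu0 * bias D k $ i"

definition pre_V :: "bm_data \<Rightarrow> nat \<Rightarrow> nat \<Rightarrow> nat \<Rightarrow> point \<Rightarrow> real" where
  "pre_V D k i j x = (\<Sum>m<width D k. weight D k $$ (i, m) * x (CV k m j))"

lemma pre_add_scaled:
  "pre_u D k i (\<lambda>c. x c + t * d c) = pre_u D k i x + t * pre_u D k i d"
  "pre_V D k i j (\<lambda>c. x c + t * d c) = pre_V D k i j x + t * pre_V D k i j d"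
  by (simp_all add: pre_u_def pre_V_def algebra_simps sum.distrib sum_distrib_left)

lemma wf_dims:
  assumes "bm_wf D"
  shows "2 \<le> depth D"
    "dim_vec (out_weight D) = width D (depth D)" "dim_vec (centre D) = width D 1"
    "\<And>k. 1 \<le> k \<Longrightarrow> k \<le> depth D \<Longrightarrow> 1 \<le> width D k"
    "\<And>k. 1 \<le> k \<Longrightarrow> k < depth D \<Longrightarrow> dim_row (weight D k) = width D (k + 1)"
    "\<And>k. 1 \<le> k \<Longrightarrow> k < depth D \<Longrightarrow> dim_col (weight D k) = width D k"
    "\<And>k. 1 \<le> k \<Longrightarrow> k < depth D \<Longrightarrow> dim_vec (bias D k) = width D (k + 1)"
  using assms by (auto simp: bm_wf_def)

lemma obj_eq:
  assumes "bm_wf D"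
  shows "obj D x = x Cu0 * (\<Sum>i<width D (depth D). out_weight D $ i * x (Cu (depth D) i))"
  using wf_dims[OF assms] by (simp add: obj_def u0_def uvec_def scalar_prod_def lessThan_atLeast0)

lemma g0_eq:
  assumes "bm_wf D"
  shows "gcon D G0 x = (\<Sum>i<width D 1. (x (Cu 1 i) - x Cu0 * centre D $ i)\<^sup>2)
    + (\<Sum>i<width D 1. \<Sum>j<frank D - 1. (x (CV 1 i j))\<^sup>2) - (radius D)\<^sup>2"
proof -
  note dims = wf_dims[OF assms]
  have *: "(L2_set f S)\<^sup>2 = (\<Sum>i\<in>S. (f i)\<^sup>2)" for f and S :: "'i set"
    by (simp add: L2_set_def sum_nonneg)
  have "(\<Sum>i<width D 1. ((uvec D x 1 - u0 x \<cdot>\<^sub>v centre D) $ i)\<^sup>2)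
      = (\<Sum>i<width D 1. (x (Cu 1 i) - x Cu0 * centre D $ i)\<^sup>2)"
    using dims by (intro sum.cong) (auto simp: u0_def uvec_def)
  moreover have "(\<Sum>ij\<in>{..<width D 1} \<times> {..<frank D - 1}. (Vmat D x 1 $$ ij)\<^sup>2)
      = (\<Sum>i<width D 1. \<Sum>j<frank D - 1. (x (CV 1 i j))\<^sup>2)"
    unfolding sum.cartesian_product by (intro sum.cong) (auto simp: Vmat_def)
  moreover have "dim_vec (uvec D x 1 - u0 x \<cdot>\<^sub>v centre D) = width D 1"
    "dim_row (Vmat D x 1) = width D 1" "dim_col (Vmat D x 1) = frank D - 1"
    using dims by (auto simp: Vmat_def)
  ultimately show ?thesis
    by (simp add: g0_def vec_norm2_def frobenius_norm_def *)
qed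

lemma pre_u_eq:
  assumes "bm_wf D" "1 \<le> k" "k < depth D" "i < width D (k + 1)"
  shows "(weight D k *\<^sub>v uvec D x k) $ i + x Cu0 * bias D k $ i = pre_u D k i x"
  using wf_dims[OF assms(1)] assms
  by (simp add: pre_u_def uvec_def scalar_prod_def lessThan_atLeast0)

lemma pre_V_eq:
  assumes "bm_wf D" "1 \<le> k" "k < depth D" "i < width D (k + 1)" "j < frank D - 1"
  shows "(weight D k * Vmat D x k) $$ (i, j) = pre_V D k i j x"
  using wf_dims[OF assms(1)] assms
  by (simp add: pre_V_def Vmat_def scalar_prod_def lessThan_atLeast0)

lemma g1_eq:
  assumes "bm_wf D" "1 \<le> k" "k < depth D" "i < width D (k + 1)"
  shows "gcon D (G1 k i) x = - (x Cu0 * x (Cu (k + 1) i))"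
  using assms by (simp add: g1_def u0_def uvec_def)

lemma g2_eq:
  assumes "bm_wf D" "1 \<le> k" "k < depth D" "i < width D (k + 1)"
  shows "gcon D (G2 k i) x = x Cu0 * (pre_u D k i x - x (Cu (k + 1) i))"
  using wf_dims[OF assms(1)] assms pre_u_eq[OF assms, of x, symmetric]
  by (simp add: g2_def u0_def uvec_def)

lemma h_eq:
  assumes "bm_wf D" "1 \<le> k" "k < depth D" "i < width D (k + 1)"
  shows "hcon D (H k i) x = (x (Cu (k + 1) i) - pre_u D k i x) * x (Cu (k + 1) i)
    + (\<Sum>j<frank D - 1. (x (CV (k + 1) i j) - pre_V D k i j x) * x (CV (k + 1) i j))"
proof -
  note dims = wf_dims[OF assms(1)]
  let ?V = "Vmat D x (k + 1)" and ?U = "weight D k * Vmat D x k"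
  have 1: "((?V - ?U) * transpose_mat ?V) $$ (i, i)
    = (\<Sum>j<frank D - 1. (x (CV (k + 1) i j) - pre_V D k i j x) * x (CV (k + 1) i j))"
  proof -
    have "((?V - ?U) * transpose_mat ?V) $$ (i, i)
        = (\<Sum>j<frank D - 1. (?V - ?U) $$ (i, j) * ?V $$ (i, j))"
      using dims assms by (simp add: scalar_prod_def Vmat_def lessThan_atLeast0)
    also have "\<dots> = (\<Sum>j<frank D - 1. (x (CV (k + 1) i j) - pre_V D k i j x) * x (CV (k + 1) i j))"
    proof (rule sum.cong)
      fix j assume "j \<in> {..<frank D - 1}"
      then show "(?V - ?U) $$ (i, j) * ?V $$ (i, j)
          = (x (CV (k + 1) i j) - pre_V D k i j x) * x (CV (k + 1) i j)"
        using pre_V_eq[OF assms, of j x] dims assms by (simp add: Vmat_def)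
    qed simp
    finally show ?thesis .
  qed
  have 2: "outer_prod (uvec D x (k + 1) - weight D k *\<^sub>v uvec D x k - u0 x \<cdot>\<^sub>v bias D k)
        (uvec D x (k + 1)) $$ (i, i)
      = (x (Cu (k + 1) i) - pre_u D k i x) * x (Cu (k + 1) i)"
    using pre_u_eq[OF assms, of x, symmetric] dims assms
    by (simp add: outer_prod_def u0_def uvec_def)
  show ?thesis
    unfolding hcon.simps hmat_def
    using 1 2 dims assms by (subst index_add_mat) (auto simp: Vmat_def)
qed

lemma h0_eq: "hcon D H0 x = 1 - (x Cu0)\<^sup>2"
  by (simp add: h0_def u0_def)

lemma NPCQ_D:
  assumes "bm_wf D" "NPCQ D x" "1 \<le> k" "k < depth D" "i < width D (k + 1)"
  shows "pre_u D k i x \<noteq> 0" "\<exists>j<frank D - 1. pre_V D k i j x \<noteq> 0"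
proof -
  note dims = wf_dims[OF assms(1)]
  have A: "(weight D k *\<^sub>v uvec D x k + u0 x \<cdot>\<^sub>v bias D k) $ i \<noteq> 0"
    and B: "row (weight D k * Vmat D x k) i \<noteq> 0\<^sub>v (frank D - 1)"
    using assms unfolding NPCQ_def by auto
  show "pre_u D k i x \<noteq> 0"
    using A pre_u_eq[OF assms(1,3-5), of x, symmetric] dims assms by (simp add: u0_def)
  show "\<exists>j<frank D - 1. pre_V D k i j x \<noteq> 0"
  proof (rule ccontr)
    assume "\<not> ?thesis"
    then have "row (weight D k * Vmat D x k) i = 0\<^sub>v (frank D - 1)"
      using pre_V_eq[OF assms(1,3-5), of _ x] dims assms by (intro eq_vecI) (auto simp: Vmat_def)
    then show False
      using B by simp
  qed
qed

lemma smooth_pre: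
  assumes "1 \<le> k" "k < depth D"
  shows "smooth_fun D (pre_u D k i)" "j < frank D - 1 \<Longrightarrow> smooth_fun D (pre_V D k i j)"
  unfolding pre_u_def[abs_def] pre_V_def[abs_def]
  by (intro smooth_fun_intros; use assms in auto)+

lemma smooth_obj: "bm_wf D \<Longrightarrow> smooth_fun D (obj D)"
  using wf_dims(1)[of D]
  by (subst ext[OF obj_eq]) (auto intro!: smooth_fun_intros)

lemma smooth_gcon:
  assumes "bm_wf D" "a \<in> ineqs D"
  shows "smooth_fun D (gcon D a)"
proof (cases a)
  case G0
  show ?thesis
    unfolding G0 ext[OF g0_eq[OF assms(1)]] using wf_dims(1)[OF assms(1)]
    by (auto intro!: smooth_fun_intros)
next
  case (G1 k i)
  then have k: "1 \<le> k" "k < depth D" "i < width D (k + 1)"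
    using assms(2) by auto
  have "smooth_fun D (\<lambda>x. 0 - (x Cu0 * x (Cu (k + 1) i)))"
    by (intro smooth_fun_intros) (use k in auto)
  then show ?thesis
    unfolding G1 ext[OF g1_eq[OF assms(1) k]] by simp
next
  case (G2 k i)
  then have k: "1 \<le> k" "k < depth D" "i < width D (k + 1)"
    using assms(2) by auto
  show ?thesis
    unfolding G2 ext[OF g2_eq[OF assms(1) k]]
    by (intro smooth_fun_intros smooth_pre) (use k in auto)
qed

lemma smooth_hcon:
  assumes "bm_wf D" "a \<in> eqs D"
  shows "smooth_fun D (hcon D a)"
proof (cases a)
  case H0
  show ?thesis
    unfolding H0 ext[OF h0_eq] by (intro smooth_fun_intros) auto
next
  case (H k i)
  then have k: "1 \<le> k" "k < depth D" "i < width D (k + 1)"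
    using assms(2) by auto
  show ?thesis
    unfolding H ext[OF h_eq[OF assms(1) k]]
    by (intro smooth_fun_intros smooth_pre) (use k in auto)
qed

lemma dirder_g0:
  assumes "bm_wf D"
  shows "dirder D (gcon D G0) x d
    = (\<Sum>i<width D 1. 2 * (x (Cu 1 i) - x Cu0 * centre D $ i) * (d (Cu 1 i) - d Cu0 * centre D $ i))
      + (\<Sum>i<width D 1. \<Sum>j<frank D - 1. 2 * x (CV 1 i j) * d (CV 1 i j))"
  unfolding ext[OF g0_eq[OF assms]]
  by (rule dirder_eqI) (use smooth_gcon[OF assms, of G0] in
      \<open>auto simp: ext[OF g0_eq[OF assms]] mult_ac intro!: derivative_eq_intros sum.cong\<close>)

lemma dirder_g1:
  assumes "bm_wf D" "1 \<le> k" "k < depth D" "i < width D (k + 1)"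
  shows "dirder D (gcon D (G1 k i)) x d
    = - (d Cu0 * x (Cu (k + 1) i) + x Cu0 * d (Cu (k + 1) i))"
proof (rule dirder_eqI[OF smooth_gcon])
  show "((\<lambda>t. gcon D (G1 k i) (\<lambda>c. x c + t * d c)) has_real_derivative
      - (d Cu0 * x (Cu (k + 1) i) + x Cu0 * d (Cu (k + 1) i))) (at 0)"
    unfolding g1_eq[OF assms] by (auto intro!: derivative_eq_intros)
qed (use assms in auto)

lemma dirder_g2:
  assumes "bm_wf D" "1 \<le> k" "k < depth D" "i < width D (k + 1)"
  shows "dirder D (gcon D (G2 k i)) x d
    = d Cu0 * (pre_u D k i x - x (Cu (k + 1) i)) + x Cu0 * (pre_u D k i d - d (Cu (k + 1) i))"
proof (rule dirder_eqI[OF smooth_gcon])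
  show "((\<lambda>t. gcon D (G2 k i) (\<lambda>c. x c + t * d c)) has_real_derivative
      d Cu0 * (pre_u D k i x - x (Cu (k + 1) i)) + x Cu0 * (pre_u D k i d - d (Cu (k + 1) i))) (at 0)"
    unfolding g2_eq[OF assms] pre_add_scaled by (auto intro!: derivative_eq_intros)
qed (use assms in auto)

lemma dirder_h0: "bm_wf D \<Longrightarrow> dirder D (hcon D H0) x d = - 2 * x Cu0 * d Cu0"
  by (rule dirder_eqI[OF smooth_hcon])
    (auto simp: h0_eq simp del: hcon.simps intro!: derivative_eq_intros)

lemma dirder_h:
  assumes "bm_wf D" "1 \<le> k" "k < depth D" "i < width D (k + 1)"
  shows "dirder D (hcon D (H k i)) x d
    = (d (Cu (k + 1) i) - pre_u D k i d) * x (Cu (k + 1) i)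
      + (x (Cu (k + 1) i) - pre_u D k i x) * d (Cu (k + 1) i)
      + (\<Sum>j<frank D - 1. (d (CV (k + 1) i j) - pre_V D k i j d) * x (CV (k + 1) i j)
          + (x (CV (k + 1) i j) - pre_V D k i j x) * d (CV (k + 1) i j))" (is "_ = ?L")
proof (rule dirder_eqI[OF smooth_hcon])
  show "((\<lambda>t. hcon D (H k i) (\<lambda>c. x c + t * d c)) has_real_derivative ?L) (at 0)"
    unfolding h_eq[OF assms] pre_add_scaled
    by (auto intro!: derivative_eq_intros sum.cong simp: mult_ac)
qed (use assms in auto)

declare gcon.simps [simp del] hcon.simps [simp del]

section \<open>A linear alternative: span or descent direction\<close>

text \<open>A dual basis \<open>e\<close> of the rows of \<open>G\<close> leaves only one candidate
  for \<open>\<mu>\<close>. If it fails in some coordinate, the kernel of \<open>G\<close> contains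
  a vector on which \<open>f\<close> does not vanish, and moving along it makes \<open>f\<close>
  negative without changing any row.\<close>

lemma span_or_descent_direction:
  fixes G :: "'a \<Rightarrow> 'c \<Rightarrow> real"
  assumes "finite C" "finite A"
    and surj: "\<And>\<beta>. \<exists>d. \<forall>a\<in>A. (\<Sum>c\<in>C. G a c * d c) = \<beta> a"
  shows "(\<exists>\<mu>. \<forall>c\<in>C. f c = (\<Sum>a\<in>A. \<mu> a * G a c))
    \<or> (\<forall>\<beta>. \<exists>d. (\<forall>a\<in>A. (\<Sum>c\<in>C. G a c * d c) = \<beta> a) \<and> (\<Sum>c\<in>C. f c * d c) < 0)"
proof -
  have "\<forall>a. \<exists>e. \<forall>b\<in>A. (\<Sum>c\<in>C. G b c * e c) = (if b = a then 1 else 0)"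
    by (intro allI surj)
  then obtain e where e: "\<And>a b. b \<in> A \<Longrightarrow> (\<Sum>c\<in>C. G b c * e a c) = (if b = a then 1 else 0)"
    by metis
  define \<mu> where "\<mu> a = (\<Sum>c\<in>C. f c * e a c)" for a
  show ?thesis
  proof (cases "\<forall>c\<in>C. f c = (\<Sum>a\<in>A. \<mu> a * G a c)")
    case False
    then obtain c0 where c0: "c0 \<in> C" "f c0 \<noteq> (\<Sum>a\<in>A. \<mu> a * G a c0)"
      by blast
    define r where "r = f c0 - (\<Sum>a\<in>A. \<mu> a * G a c0)"
    \<comment> \<open>The unit vector of \<open>c0\<close>, corrected to be annihilated by all rows of \<open>G\<close>.\<close>
    define v where "v c = (if c = c0 then 1 else 0) - (\<Sum>a\<in>A. G a c0 * e a c)" for c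
    have expand: "(\<Sum>c\<in>C. F c * v c) = F c0 - (\<Sum>a\<in>A. G a c0 * (\<Sum>c\<in>C. F c * e a c))"
      for F :: "'c \<Rightarrow> real"
    proof -
      have "(\<Sum>c\<in>C. F c * v c) = (\<Sum>c\<in>C. F c * (if c = c0 then 1 else 0))
          - (\<Sum>c\<in>C. \<Sum>a\<in>A. G a c0 * (F c * e a c))"
        by (simp add: v_def right_diff_distrib sum_subtractf sum_distrib_left mult_ac)
      also have "(\<Sum>c\<in>C. \<Sum>a\<in>A. G a c0 * (F c * e a c)) = (\<Sum>a\<in>A. G a c0 * (\<Sum>c\<in>C. F c * e a c))"
        by (subst sum.swap) (simp add: sum_distrib_left)
      also have "(\<Sum>c\<in>C. F c * (if c = c0 then 1 else 0)) = F c0"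
        using c0(1) \<open>finite C\<close> by (simp add: if_distrib[of "\<lambda>a. _ * a"] cong: if_cong)
      finally show ?thesis .
    qed
    have Gv: "(\<Sum>c\<in>C. G b c * v c) = 0" if "b \<in> A" for b
    proof -
      have "(\<Sum>a\<in>A. G a c0 * (\<Sum>c\<in>C. G b c * e a c)) = (\<Sum>a\<in>A. if b = a then G a c0 else 0)"
        using e[OF that] by (intro sum.cong) auto
      with that \<open>finite A\<close> show ?thesis
        by (simp add: expand)
    qed
    have fv: "(\<Sum>c\<in>C. f c * v c) = r"
      by (simp add: expand r_def \<mu>_def mult.commute)
    have "\<exists>d. (\<forall>a\<in>A. (\<Sum>c\<in>C. G a c * d c) = \<beta> a) \<and> (\<Sum>c\<in>C. f c * d c) < 0" for \<beta>
    proof -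
      obtain d where d: "\<And>a. a \<in> A \<Longrightarrow> (\<Sum>c\<in>C. G a c * d c) = \<beta> a"
        using surj by blast
      \<comment> \<open>Scaled so that the value of \<open>f\<close> on the corrected direction is
        exactly -1.\<close>
      define s where "s = (- 1 - (\<Sum>c\<in>C. f c * d c)) / r"
      have lin: "(\<Sum>c\<in>C. F c * (d c + s * v c)) = (\<Sum>c\<in>C. F c * d c) + s * (\<Sum>c\<in>C. F c * v c)"
        for F :: "'c \<Rightarrow> real"
        by (simp add: distrib_left sum.distrib sum_distrib_left mult_ac)
      have "s * r = - 1 - (\<Sum>c\<in>C. f c * d c)"
        using c0(2) by (simp add: s_def r_def)
      then show ?thesis
        by (intro exI[of _ "\<lambda>c. d c + s * v c"]) (simp add: lin Gv d fv)
    qed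
    then show ?thesis
      by blast
  qed blast
qed

section \<open>Surjectivity of the linearised active constraints\<close>

text \<open>On the sphere the normal \<open>(2 s - a, 2 q - v)\<close> has the same length as
  \<open>(a, v)\<close>. If \<open>s\<close> is \<open>0\<close> or \<open>a\<close>, the summand
  \<open>(s - a) * s\<close> vanishes and the \<open>q\<close>-part alone has the length of
  \<open>v\<close>; then \<open>ds\<close> serves the inequality and \<open>dq\<close> the
  sphere.\<close>

lemma neuron_linearisation_surj:
  fixes s a :: real and q v :: "'j \<Rightarrow> real"
  assumes "finite J" and sphere: "(s - a) * s + (\<Sum>j\<in>J. (q j - v j) * q j) = 0"
    and "a \<noteq> 0" "j0 \<in> J" "v j0 \<noteq> 0"
  shows "\<exists>ds dq. (s = 0 \<longrightarrow> ds = \<beta>1) \<and> (s = a \<longrightarrow> ds = \<beta>2) \<and>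
    (2 * s - a) * ds + (\<Sum>j\<in>J. (2 * q j - v j) * dq j) = \<gamma>"
proof -
  have sq: "(\<Sum>j\<in>J. (2 * q j - v j)\<^sup>2) = (\<Sum>j\<in>J. (v j)\<^sup>2) + 4 * (\<Sum>j\<in>J. (q j - v j) * q j)"
    unfolding sum_distrib_left sum.distrib[symmetric]
    by (intro sum.cong refl) (simp add: power2_eq_square algebra_simps)
  have v_pos: "(\<Sum>j\<in>J. (v j)\<^sup>2) > 0"
    using assms by (intro sum_pos2[of _ j0]) auto
  define N where "N = (\<Sum>j\<in>J. (2 * q j - v j)\<^sup>2)"
  have N: "(\<Sum>j\<in>J. (2 * q j - v j) * (\<kappa> * (2 * q j - v j))) = \<kappa> * N" for \<kappa>
    by (simp add: N_def sum_distrib_left power2_eq_square mult_ac)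
  show ?thesis
  proof (cases "s = 0 \<or> s = a")
    case True
    then have "N > 0"
      using sphere sq v_pos by (auto simp: N_def)
    define ds where "ds = (if s = 0 then \<beta>1 else \<beta>2)"
    define \<kappa> where "\<kappa> = (\<gamma> - (2 * s - a) * ds) / N"
    have "\<kappa> * N = \<gamma> - (2 * s - a) * ds"
      using \<open>N > 0\<close> by (simp add: \<kappa>_def)
    then have "(2 * s - a) * ds + (\<Sum>j\<in>J. (2 * q j - v j) * (\<kappa> * (2 * q j - v j))) = \<gamma>"
      by (simp add: N)
    \<comment> \<open>By \<open>a \<noteq> 0\<close> only one of the two prescriptions can
      apply.\<close>
    moreover have "s = 0 \<longrightarrow> ds = \<beta>1" "s = a \<longrightarrow> ds = \<beta>2"
      using \<open>a \<noteq> 0\<close> by (auto simp: ds_def)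
    ultimately show ?thesis
      by (intro exI[of _ ds] exI[of _ "\<lambda>j. \<kappa> * (2 * q j - v j)"]) blast
  next
    case False
    have "(2 * s - a)\<^sup>2 + N = a\<^sup>2 + (\<Sum>j\<in>J. (v j)\<^sup>2) + 4 * ((s - a) * s + (\<Sum>j\<in>J. (q j - v j) * q j))"
      unfolding N_def sq by (simp add: power2_eq_square algebra_simps)
    then have pos: "(2 * s - a)\<^sup>2 + N > 0"
      using sphere v_pos by (simp add: add_nonneg_pos)
    \<comment> \<open>With \<open>ds\<close> unconstrained, a multiple of the full normal reaches
      \<open>\<gamma>\<close>.\<close>
    define \<kappa> where "\<kappa> = \<gamma> / ((2 * s - a)\<^sup>2 + N)"
    have "(2 * s - a) * (\<kappa> * (2 * s - a)) + \<kappa> * N = \<kappa> * ((2 * s - a)\<^sup>2 + N)"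
      by (simp add: power2_eq_square algebra_simps)
    also have "\<dots> = \<gamma>"
      using pos by (simp add: \<kappa>_def)
    finally show ?thesis
      using False
      by (intro exI[of _ "\<kappa> * (2 * s - a)"] exI[of _ "\<lambda>j. \<kappa> * (2 * q j - v j)"]) (simp add: N)
  qed
qed

lemma feasible_u0:
  assumes "bm_feasible D x"
  shows "(x Cu0)\<^sup>2 = 1" "x Cu0 \<noteq> 0"
proof -
  have "hcon D H0 x = 0"
    using assms by (simp add: bm_feasible_def)
  then show "(x Cu0)\<^sup>2 = 1" "x Cu0 \<noteq> 0"
    by (auto simp: h0_eq)
qed

text \<open>If \<open>V\<^sub>1\<close> vanished, so would \<open>W\<^sub>1 V\<^sub>1\<close>, and
  layer 2 has a neuron to contradict this. The consequence is that \<open>G0\<close> can be moved at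
  any rate by scaling \<open>V\<^sub>1\<close>.\<close>

lemma NPCQ_V1:
  assumes "bm_wf D" "NPCQ D x"
  shows "(\<Sum>i<width D 1. \<Sum>j<frank D - 1. (x (CV 1 i j))\<^sup>2) > 0"
proof -
  have "1 < depth D" "0 < width D (1 + 1)"
    using wf_dims(1)[OF assms(1)] wf_dims(4)[OF assms(1), of 2]
    by (simp_all add: numeral_2_eq_2)
  then obtain j where j: "j < frank D - 1" "pre_V D 1 0 j x \<noteq> 0"
    using NPCQ_D(2)[OF assms, of 1 0] by auto
  then obtain m where m: "m < width D 1" "x (CV 1 m j) \<noteq> 0"
    unfolding pre_V_def by (metis (no_types, lifting) lessThan_iff mult_zero_right sum.neutral)
  have "(\<Sum>j<frank D - 1. (x (CV 1 m j))\<^sup>2) > 0"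
    using j m by (intro sum_pos2[of _ j]) auto
  with m show ?thesis
    by (intro sum_pos2[of "{..<width D 1}" m]) (auto simp: sum_nonneg)
qed

text \<open>The neuron sees the rest of a direction only through \<open>d0\<close>,
  \<open>da\<close> and \<open>dv\<close>, which are fixed beforehand. Quantifying over all
  \<open>d\<close> with these data lets \<open>ds\<close> and \<open>dq\<close> be chosen before the
  direction is assembled.\<close>

lemma linearised_layer:
  assumes wf: "bm_wf D" and npcq: "NPCQ D x" and feas: "bm_feasible D x"
    and k: "1 \<le> k" "k < depth D" "i < width D (k + 1)"
  shows "\<exists>ds dq. \<forall>d. d Cu0 = d0 \<longrightarrow> pre_u D k i d = da \<longrightarrow> (\<forall>j<frank D - 1. pre_V D k i j d = dv j) \<longrightarrow>
      d (Cu (k + 1) i) = ds \<longrightarrow> (\<forall>j<frank D - 1. d (CV (k + 1) i j) = dq j) \<longrightarrow>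
      (gcon D (G1 k i) x = 0 \<longrightarrow> dirder D (gcon D (G1 k i)) x d = \<beta>1) \<and>
      (gcon D (G2 k i) x = 0 \<longrightarrow> dirder D (gcon D (G2 k i)) x d = \<beta>2) \<and>
      dirder D (hcon D (H k i)) x d = \<gamma>"
proof -
  define s where "s = x (Cu (k + 1) i)"
  define q where "q j = x (CV (k + 1) i j)" for j
  define a where "a = pre_u D k i x"
  define v where "v j = pre_V D k i j x" for j
  define u where "u = x Cu0"
  have u: "u \<noteq> 0"
    using feasible_u0[OF feas] by (simp add: u_def)
  have sphere: "(s - a) * s + (\<Sum>j<frank D - 1. (q j - v j) * q j) = 0"
    using feas k h_eq[OF wf k, of x] unfolding bm_feasible_def s_def q_def a_def v_def
    by (metis eqs_iff(2))
  obtain j0 where j0: "j0 < frank D - 1" "v j0 \<noteq> 0"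
    using NPCQ_D(2)[OF wf npcq k] by (auto simp: v_def)
  have "a \<noteq> 0"
    using NPCQ_D(1)[OF wf npcq k] by (simp add: a_def)
  \<comment> \<open>As \<open>u \<noteq> 0\<close>, \<open>G1\<close> is active iff
    \<open>s = 0\<close> and \<open>G2\<close> iff \<open>s = a\<close>; there their derivatives are
    \<open>- (u * ds)\<close> and \<open>u * (da - ds)\<close>, and solving for \<open>ds\<close>
    gives the prescribed values. The terms of the sphere derivative in \<open>da\<close> and
    \<open>dv\<close> move to the right-hand side.\<close>
  obtain ds dq where
    1: "s = 0 \<longrightarrow> ds = (- \<beta>1) / u" and 2: "s = a \<longrightarrow> ds = da - \<beta>2 / u" and
    3: "(2 * s - a) * ds + (\<Sum>j<frank D - 1. (2 * q j - v j) * dq j)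
        = \<gamma> + da * s + (\<Sum>j<frank D - 1. dv j * q j)"
    using neuron_linearisation_surj[OF finite_lessThan sphere \<open>a \<noteq> 0\<close>, of j0 "(- \<beta>1) / u"
        "da - \<beta>2 / u" "\<gamma> + da * s + (\<Sum>j<frank D - 1. dv j * q j)"] j0 by auto
  show ?thesis
  proof (intro exI[of _ ds] exI[of _ dq] allI impI)
    fix d
    assume d: "d Cu0 = d0" "pre_u D k i d = da" "\<forall>j<frank D - 1. pre_V D k i j d = dv j"
      "d (Cu (k + 1) i) = ds" "\<forall>j<frank D - 1. d (CV (k + 1) i j) = dq j"
    have x: "x (Cu (k + 1) i) = s" "x Cu0 = u" "pre_u D k i x = a"
      "\<And>j. x (CV (k + 1) i j) = q j" "\<And>j. pre_V D k i j x = v j"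
      by (simp_all add: s_def u_def a_def q_def v_def)
    have "gcon D (G1 k i) x = 0 \<longrightarrow> dirder D (gcon D (G1 k i)) x d = \<beta>1"
      unfolding g1_eq[OF wf k] dirder_g1[OF wf k] x d using 1 u by auto
    moreover have "gcon D (G2 k i) x = 0 \<longrightarrow> dirder D (gcon D (G2 k i)) x d = \<beta>2"
      unfolding g2_eq[OF wf k] dirder_g2[OF wf k] x d using 2 u by auto
    moreover have "dirder D (hcon D (H k i)) x d = \<gamma>"
    proof -
      have "(\<Sum>j<frank D - 1. (d (CV (k + 1) i j) - pre_V D k i j d) * q j
            + (q j - v j) * d (CV (k + 1) i j))
          = (\<Sum>j<frank D - 1. (2 * q j - v j) * dq j) - (\<Sum>j<frank D - 1. dv j * q j)"
        unfolding sum_subtractf[symmetric]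
        by (intro sum.cong) (use d in \<open>simp_all add: algebra_simps\<close>)
      with 3 show ?thesis
        unfolding dirder_h[OF wf k] x d by (simp only:) (simp add: algebra_simps)
    qed
    ultimately show "(gcon D (G1 k i) x = 0 \<longrightarrow> dirder D (gcon D (G1 k i)) x d = \<beta>1) \<and>
      (gcon D (G2 k i) x = 0 \<longrightarrow> dirder D (gcon D (G2 k i)) x d = \<beta>2) \<and>
      dirder D (hcon D (H k i)) x d = \<gamma>"
      by blast
  qed
qed

definition override_layer ::
    "nat \<Rightarrow> (nat \<Rightarrow> real) \<Rightarrow> (nat \<Rightarrow> nat \<Rightarrow> real) \<Rightarrow> point \<Rightarrow> point" where
  "override_layer k s q x c = (case c of
     Cu0 \<Rightarrow> x c
   | Cu m i \<Rightarrow> if m = k then s i else x c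
   | CV m i j \<Rightarrow> if m = k then q i j else x c)"

lemma override_layer_simps [simp]:
  "override_layer k s q x Cu0 = x Cu0"
  "override_layer k s q x (Cu m i) = (if m = k then s i else x (Cu m i))"
  "override_layer k s q x (CV m i j) = (if m = k then q i j else x (CV m i j))"
  by (simp_all add: override_layer_def)

text \<open>Constraint index \<open>m\<close> reads layer \<open>m\<close> through its
  pre-activations and layer \<open>m + 1\<close> directly. After overriding layer \<open>k\<close>,
  the indices with \<open>m + 1 < k\<close> are untouched, so a forward sweep never spoils what it
  has settled.\<close>

lemma pre_override_layer [simp]:
  "m \<noteq> k \<Longrightarrow> pre_u D m i (override_layer k s q x) = pre_u D m i x"
  "m \<noteq> k \<Longrightarrow> pre_V D m i j (override_layer k s q x) = pre_V D m i j x"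
  by (simp_all add: pre_u_def pre_V_def)

text \<open>The linear independence constraint qualification in dual form: instead of independent
  active gradients, arbitrary prescribable derivatives. The induction settles one more layer per
  step.\<close>

lemma linearisation_surj:
  assumes wf: "bm_wf D" and npcq: "NPCQ D x" and feas: "bm_feasible D x"
  shows "\<exists>d. (\<forall>a\<in>ineqs D. gcon D a x = 0 \<longrightarrow> dirder D (gcon D a) x d = \<beta> a)
    \<and> (\<forall>a\<in>eqs D. dirder D (hcon D a) x d = \<gamma> a)"
proof -
  define good where "good d k i \<longleftrightarrow>
      (gcon D (G1 k i) x = 0 \<longrightarrow> dirder D (gcon D (G1 k i)) x d = \<beta> (G1 k i)) \<and>
      (gcon D (G2 k i) x = 0 \<longrightarrow> dirder D (gcon D (G2 k i)) x d = \<beta> (G2 k i)) \<and>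
      dirder D (hcon D (H k i)) x d = \<gamma> (H k i)" for d k i
  have "\<exists>d. dirder D (hcon D H0) x d = \<gamma> H0 \<and> dirder D (gcon D G0) x d = \<beta> G0 \<and>
      (\<forall>k i. 1 \<le> k \<longrightarrow> k \<le> n \<longrightarrow> i < width D (k + 1) \<longrightarrow> good d k i)" if "n < depth D" for n
    using that
  proof (induction n)
    case 0
    \<comment> \<open>\<open>H0\<close> forces the \<open>u\<^sub>0\<close> component
      \<open>d0\<close>. Scaling the \<open>V\<close> entries by \<open>\<kappa>\<close> then
      compensates in \<open>G0\<close> for the contribution \<open>B\<close> of \<open>d0\<close>.
      Entries of later layers are placeholders, overwritten by the sweep.\<close>
    define d0 where "d0 = - \<gamma> H0 / (2 * x Cu0)"
    define N where "N = (\<Sum>i<width D 1. \<Sum>j<frank D - 1. (x (CV 1 i j))\<^sup>2)"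
    define B where "B = (\<Sum>i<width D 1. 2 * (x (Cu 1 i) - x Cu0 * centre D $ i) * (0 - d0 * centre D $ i))"
    define \<kappa> where "\<kappa> = (\<beta> G0 - B) / (2 * N)"
    define d where "d = (\<lambda>c. case c of Cu0 \<Rightarrow> d0 | Cu _ _ \<Rightarrow> 0 | CV _ _ _ \<Rightarrow> \<kappa> * x c)"
    have "dirder D (hcon D H0) x d = \<gamma> H0"
      using feasible_u0(2)[OF feas] by (simp add: dirder_h0[OF wf] d_def d0_def)
    moreover have "dirder D (gcon D G0) x d = \<beta> G0"
    proof -
      have "(\<Sum>i<width D 1. \<Sum>j<frank D - 1. 2 * x (CV 1 i j) * d (CV 1 i j)) = 2 * \<kappa> * N"
        by (simp add: d_def N_def sum_distrib_left power2_eq_square mult_ac)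
      moreover have "N > 0"
        using NPCQ_V1[OF wf npcq] by (simp add: N_def)
      ultimately show ?thesis
        unfolding dirder_g0[OF wf] by (simp add: d_def \<kappa>_def flip: B_def[simplified])
    qed
    ultimately show ?case
      by (intro exI[of _ d]) simp
  next
    case (Suc n)
    then obtain d where d: "dirder D (hcon D H0) x d = \<gamma> H0" "dirder D (gcon D G0) x d = \<beta> G0"
        "\<And>k i. 1 \<le> k \<Longrightarrow> k \<le> n \<Longrightarrow> i < width D (k + 1) \<Longrightarrow> good d k i"
      using Suc_lessD by blast
    let ?k = "Suc n"
    have k: "1 \<le> ?k" "?k < depth D"
      using Suc.prems by auto
    \<comment> \<open>\<open>Q\<close> demands success for every direction agreeing with
      \<open>d\<close> on the inputs of neuron \<open>i\<close>, so the values for all neurons of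
      the layer can be chosen separately and written in at once.\<close>
    define Q where "Q i ds dq \<longleftrightarrow> (\<forall>d'. d' Cu0 = d Cu0 \<longrightarrow> pre_u D ?k i d' = pre_u D ?k i d \<longrightarrow>
        (\<forall>j<frank D - 1. pre_V D ?k i j d' = pre_V D ?k i j d) \<longrightarrow> d' (Cu (?k + 1) i) = ds \<longrightarrow>
        (\<forall>j<frank D - 1. d' (CV (?k + 1) i j) = dq j) \<longrightarrow> good d' ?k i)" for i ds dq
    have "\<exists>ds dq. Q i ds dq" if "i < width D (?k + 1)" for i
      unfolding Q_def good_def by (rule linearised_layer[OF wf npcq feas k that])
    then obtain s q where sq: "\<And>i. i < width D (?k + 1) \<Longrightarrow> Q i (s i) (q i)"
      by metis
    define d' where "d' = override_layer (?k + 1) s q d"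
    have "good d' k i" if "1 \<le> k" "k \<le> ?k" "i < width D (k + 1)" for k i
    proof (cases "k = ?k")
      case True
      then show ?thesis
        using sq[of i] that by (simp add: Q_def d'_def)
    next
      case False
      then have k': "1 \<le> k" "k < depth D" "i < width D (k + 1)" "k \<le> n"
        using that k by auto
      then show ?thesis
        using d(3)[OF k'(1,4,3)] k'(4)
        unfolding good_def dirder_g1[OF wf k'(1-3)] dirder_g2[OF wf k'(1-3)] dirder_h[OF wf k'(1-3)]
        by (simp add: d'_def)
    qed
    \<comment> \<open>\<open>H0\<close> and \<open>G0\<close> read only \<open>u\<^sub>0\<close> and
      layer 1, and the overridden layer \<open>?k + 1\<close> is at least layer 2.\<close>
    moreover have "dirder D (hcon D H0) x d' = \<gamma> H0" "dirder D (gcon D G0) x d' = \<beta> G0"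
      using d(1,2) unfolding dirder_h0[OF wf] dirder_g0[OF wf] by (simp_all add: d'_def)
    ultimately show ?case
      by (intro exI[of _ d']) blast
  qed
  moreover have "depth D - 1 < depth D" "\<And>k. k \<le> depth D - 1 \<longleftrightarrow> k < depth D"
    using wf_dims(1)[OF wf] by auto
  ultimately obtain d where d: "dirder D (hcon D H0) x d = \<gamma> H0" "dirder D (gcon D G0) x d = \<beta> G0"
    "\<And>k i. 1 \<le> k \<Longrightarrow> k < depth D \<Longrightarrow> i < width D (k + 1) \<Longrightarrow> good d k i"
    by metis
  have "dirder D (gcon D a) x d = \<beta> a" if "a \<in> ineqs D" "gcon D a x = 0" for a
    using that d by (cases a) (auto simp: good_def)
  moreover have "dirder D (hcon D a) x d = \<gamma> a" if "a \<in> eqs D" for a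
    using that d by (cases a) (auto simp: good_def)
  ultimately show ?thesis
    by blast
qed

section \<open>One-sided derivatives and C1 functions of one variable\<close>

text \<open>Turns bounds along a path into bounds on its initial rate of change: for the objective,
  the active inequalities and both signs of the equalities.\<close>

lemma derivative_le_if_linear_bound:
  fixes f :: "real \<Rightarrow> real"
  assumes der: "(f has_real_derivative l) (at 0 within {0..<\<epsilon>})" and "0 < \<epsilon>"
    and le: "\<And>t. 0 \<le> t \<Longrightarrow> t < \<epsilon> \<Longrightarrow> f t \<le> f 0 + m * t"
  shows "l \<le> m"
proof -
  have "(f has_real_derivative l) (at 0 within {0..\<epsilon> / 2})"
    using der by (rule DERIV_subset) (use \<open>0 < \<epsilon>\<close> in auto)
  then have "((\<lambda>t. (f t - f 0) / t) \<longlongrightarrow> l) (at_right 0)"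
    using \<open>0 < \<epsilon>\<close> by (simp add: has_field_derivative_iff at_within_Icc_at_right)
  moreover have "eventually (\<lambda>t. (f t - f 0) / t \<le> m) (at_right 0)"
    unfolding eventually_at_right_field
  proof (intro exI conjI allI impI)
    fix t assume "0 < t" "t < \<epsilon>"
    then show "(f t - f 0) / t \<le> m"
      using le[of t] by (simp add: divide_simps algebra_simps)
  qed fact
  ultimately show ?thesis
    by (rule tendsto_upperbound) simp
qed

text \<open>The converse passage, from directions to paths: the gap between the slopes absorbs the
  error of the linear approximation.\<close>

lemma eventually_linear_bound_if_derivative_less:
  fixes f :: "real \<Rightarrow> real"
  assumes der: "(f has_real_derivative l) (at 0)" and "l < m"
  shows "eventually (\<lambda>t. f t \<le> f 0 + m * t) (at_right 0)"
proof -
  have "(f has_real_derivative l) (at_right 0)"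
    using der by (rule has_field_derivative_at_within)
  then have "((\<lambda>t. (f t - f 0) / t) \<longlongrightarrow> l) (at_right 0)"
    by (simp add: has_field_derivative_iff)
  then have "eventually (\<lambda>t. (f t - f 0) / t < m) (at_right 0)"
    using \<open>l < m\<close> by (rule order_tendstoD)
  moreover have "eventually (\<lambda>t::real. 0 < t) (at_right 0)"
    by (rule eventually_at_right_less)
  ultimately show ?thesis
    by eventually_elim (simp add: divide_simps algebra_simps)
qed

lemma C1_differentiable_on_sum:
  fixes f :: "'i \<Rightarrow> real \<Rightarrow> real"
  assumes "\<And>i. i \<in> I \<Longrightarrow> f i C1_differentiable_on S"
  shows "(\<lambda>t. \<Sum>i\<in>I. f i t) C1_differentiable_on S"
proof (cases "finite I")
  case True
  then show ?thesis
    using assms by (induction I) auto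
qed simp

lemma C1_differentiable_on_chain:
  fixes f g :: "real \<Rightarrow> real"
  assumes "f C1_differentiable_on S"
    and g: "\<And>t. t \<in> S \<Longrightarrow> (g has_real_derivative g' (f t)) (at (f t))" "continuous_on (f ` S) g'"
  shows "(\<lambda>t. g (f t)) C1_differentiable_on S"
proof -
  obtain f' where f': "\<And>t. t \<in> S \<Longrightarrow> (f has_real_derivative f' t) (at t)" "continuous_on S f'"
    using assms(1) unfolding C1_differentiable_on_def has_real_derivative_iff_has_vector_derivative
    by blast
  have "((\<lambda>t. g (f t)) has_real_derivative g' (f t) * f' t) (at t)" if "t \<in> S" for t
    using DERIV_chain2[OF g(1)[OF that] f'(1)[OF that]] .
  moreover have "continuous_on S (\<lambda>t. g' (f t) * f' t)"
    using continuous_on_compose2[OF g(2) C1_differentiable_imp_continuous_on[OF assms(1)]] f'(2)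
    by (intro continuous_intros) auto
  ultimately show ?thesis
    unfolding C1_differentiable_on_def has_real_derivative_iff_has_vector_derivative
    by (intro exI[of _ "\<lambda>t. g' (f t) * f' t"]) blast
qed

lemma C1_differentiable_on_inverse:
  fixes f :: "real \<Rightarrow> real"
  assumes "f C1_differentiable_on S" "\<And>t. t \<in> S \<Longrightarrow> f t \<noteq> 0"
  shows "(\<lambda>t. inverse (f t)) C1_differentiable_on S"
  using assms(1)
proof (rule C1_differentiable_on_chain[where g' = "\<lambda>y. - (inverse y)\<^sup>2"])
  show "(inverse has_real_derivative - (inverse (f t))\<^sup>2) (at (f t))" if "t \<in> S" for t
    using DERIV_inverse[of "f t" UNIV] assms(2)[OF that] by (simp add: numeral_2_eq_2)
  show "continuous_on (f ` S) (\<lambda>y. - (inverse y)\<^sup>2)"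
    using assms(2) by (intro continuous_intros) auto
qed

lemma C1_differentiable_on_sqrt:
  fixes f :: "real \<Rightarrow> real"
  assumes "f C1_differentiable_on S" "\<And>t. t \<in> S \<Longrightarrow> 0 < f t"
  shows "(\<lambda>t. sqrt (f t)) C1_differentiable_on S"
  using assms(1)
proof (rule C1_differentiable_on_chain[where g' = "\<lambda>y. inverse (sqrt y) / 2"])
  show "(sqrt has_real_derivative inverse (sqrt (f t)) / 2) (at (f t))" if "t \<in> S" for t
    using assms(2)[OF that] by (rule DERIV_real_sqrt)
  show "continuous_on (f ` S) (\<lambda>y. inverse (sqrt y) / 2)"
    using assms(2) by (intro continuous_intros) force+
qed

lemma C1_differentiable_on_has_derivative:
  fixes f :: "real \<Rightarrow> real"
  assumes "f C1_differentiable_on S" "t \<in> S"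
  obtains f' where "(f has_real_derivative f') (at t)"
  using assms unfolding C1_differentiable_on_def has_real_derivative_iff_has_vector_derivative
  by blast

section \<open>Feasible arcs by radial projection\<close>

text \<open>Multiplying the offset of \<open>(s, q)\<close> from the centre
  \<open>(a, v) / 2\<close> by the ratio \<open>L\<close> of radius to distance lands on the sphere.
  As \<open>E\<close> and its derivative vanish at 0, radius and distance agree there to first
  order, so \<open>L\<close> is stationary with value 1 and the correction preserves tangents. The
  condition \<open>a 0 \<noteq> 0\<close> keeps the radius positive near 0.\<close>

lemma radial_projection:
  fixes a s :: "real \<Rightarrow> real" and v q :: "'j \<Rightarrow> real \<Rightarrow> real"
  assumes J: "finite J" and "0 < \<epsilon>"
    and C1: "a C1_differentiable_on {0..<\<epsilon>}" "s C1_differentiable_on {0..<\<epsilon>}"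
      "\<And>j. j \<in> J \<Longrightarrow> v j C1_differentiable_on {0..<\<epsilon>}" "\<And>j. j \<in> J \<Longrightarrow> q j C1_differentiable_on {0..<\<epsilon>}"
    and a0: "a 0 \<noteq> 0"
    and E_def: "\<And>t. E t = (s t - a t) * s t + (\<Sum>j\<in>J. (q j t - v j t) * q j t)"
    and E0: "E 0 = 0" "(E has_real_derivative 0) (at 0)"
  shows "\<exists>\<eta> L. 0 < \<eta> \<and> \<eta> \<le> \<epsilon> \<and> L 0 = 1 \<and> (L has_real_derivative 0) (at 0) \<and>
    L C1_differentiable_on {0..<\<eta>} \<and>
    (\<forall>t\<in>{0..<\<eta>}. (a t / 2 + L t * (s t - a t / 2) - a t) * (a t / 2 + L t * (s t - a t / 2))
      + (\<Sum>j\<in>J. (v j t / 2 + L t * (q j t - v j t / 2) - v j t) * (v j t / 2 + L t * (q j t - v j t / 2))) = 0)"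
proof -
  \<comment> \<open>\<open>N\<close> is the squared radius of the sphere around \<open>(a, v) / 2\<close> and \<open>M\<close> the squared distance of
    \<open>(s, q)\<close> from its centre.\<close>
  define N where "N t = (a t * a t + (\<Sum>j\<in>J. v j t * v j t)) * (1 / 4)" for t
  define M where "M t = N t + E t" for t
  define L where "L t = sqrt (N t * inverse (M t))" for t
  have N_C1: "N C1_differentiable_on {0..<\<epsilon>}"
    unfolding N_def[abs_def]
    by (intro C1_differentiable_on_mult C1_differentiable_on_add C1_differentiable_on_sum
        C1_differentiable_on_const C1)
  have E_C1: "E C1_differentiable_on {0..<\<epsilon>}"
    unfolding ext[OF E_def]
    by (intro C1_differentiable_on_mult C1_differentiable_on_add C1_differentiable_on_diff
        C1_differentiable_on_sum C1)
  have M_C1: "M C1_differentiable_on {0..<\<epsilon>}"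
    unfolding M_def[abs_def] by (intro C1_differentiable_on_add N_C1 E_C1)
  have N0: "N 0 > 0"
  proof -
    have "0 < a 0 * a 0"
      using a0 not_real_square_gt_zero by blast
    moreover have "0 \<le> (\<Sum>j\<in>J. v j 0 * v j 0)"
      by (intro sum_nonneg) simp
    ultimately show ?thesis
      by (simp add: N_def)
  qed
  have M0: "M 0 = N 0"
    by (simp add: M_def E0)
  have "0 \<in> {0..<\<epsilon>}"
    using \<open>0 < \<epsilon>\<close> by simp
  then obtain N' where N': "(N has_real_derivative N') (at 0)"
    using C1_differentiable_on_has_derivative[OF N_C1] by blast
  have M': "(M has_real_derivative N') (at 0)"
    unfolding M_def[abs_def] using DERIV_add[OF N' E0(2)] by simp
  have "eventually (\<lambda>t. N t > 0) (at 0)" "eventually (\<lambda>t. M t > 0) (at 0)"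
    using DERIV_isCont[OF N'] DERIV_isCont[OF M'] N0 M0
    unfolding isCont_def by (auto intro: order_tendstoD)
  then have "eventually (\<lambda>t. N t > 0 \<and> M t > 0) (at 0)"
    by (rule eventually_conj)
  then obtain r where r: "r > 0" "\<And>t. t \<noteq> 0 \<Longrightarrow> dist t 0 < r \<Longrightarrow> N t > 0 \<and> M t > 0"
    unfolding eventually_at by auto
  \<comment> \<open>On this interval \<open>N\<close> and \<open>M\<close> stay positive, so the
    inverse and the square root are C1.\<close>
  define \<eta> where "\<eta> = min r \<epsilon>"
  have pos: "N t > 0" "M t > 0" if "t \<in> {0..<\<eta>}" for t
    using r(2)[of t] that N0 M0 by (cases "t = 0"; simp add: \<eta>_def dist_real_def)+
  have "{0..<\<eta>} \<subseteq> {0..<\<epsilon>}"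
    by (auto simp: \<eta>_def)
  note C1' = C1_differentiable_on_subset[OF N_C1 this] C1_differentiable_on_subset[OF M_C1 this]
  have L_C1: "L C1_differentiable_on {0..<\<eta>}"
    unfolding L_def[abs_def]
    by (intro C1_differentiable_on_sqrt C1_differentiable_on_mult C1_differentiable_on_inverse C1')
      (use pos in \<open>auto simp: less_imp_neq[symmetric]\<close>)
  have L': "(L has_real_derivative 0) (at 0)"
  proof -
    have "((\<lambda>t. N t * inverse (M t)) has_real_derivative 0) (at 0)"
      using DERIV_mult[OF N' DERIV_inverse_fun[OF M']] N0 M0 by (simp add: field_simps)
    moreover have "(sqrt has_real_derivative inverse (sqrt (N 0 * inverse (M 0))) / 2)
        (at (N 0 * inverse (M 0)))"
      using N0 M0 by (intro DERIV_real_sqrt) simp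
    from DERIV_chain2[OF this calculation] show ?thesis
      unfolding L_def[abs_def] by simp
  qed
  have "(a t / 2 + L t * (s t - a t / 2) - a t) * (a t / 2 + L t * (s t - a t / 2))
      + (\<Sum>j\<in>J. (v j t / 2 + L t * (q j t - v j t / 2) - v j t) * (v j t / 2 + L t * (q j t - v j t / 2))) = 0"
    if t: "t \<in> {0..<\<eta>}" for t
  proof -
    \<comment> \<open>Relative to the centre, the sphere expression is squared offset minus squared
      radius, so scaling the offset by \<open>l\<close> turns \<open>M - N\<close> into
      \<open>l^2 * M - N\<close>. This is the contribution of a single coordinate.\<close>
    have scale: "(v / 2 + l * (q - v / 2) - v) * (v / 2 + l * (q - v / 2))
        = l\<^sup>2 * ((q - v) * q) + (l\<^sup>2 - 1) * (v * v * (1 / 4))" for l q v :: real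
      by (simp add: power2_eq_square field_simps)
    have "(a t / 2 + L t * (s t - a t / 2) - a t) * (a t / 2 + L t * (s t - a t / 2))
      + (\<Sum>j\<in>J. (v j t / 2 + L t * (q j t - v j t / 2) - v j t) * (v j t / 2 + L t * (q j t - v j t / 2)))
      = (L t)\<^sup>2 * E t + ((L t)\<^sup>2 - 1) * N t"
    proof -
      have "(\<Sum>j\<in>J. (v j t / 2 + L t * (q j t - v j t / 2) - v j t) * (v j t / 2 + L t * (q j t - v j t / 2)))
        = (L t)\<^sup>2 * (\<Sum>j\<in>J. (q j t - v j t) * q j t) + ((L t)\<^sup>2 - 1) * ((\<Sum>j\<in>J. v j t * v j t) * (1 / 4))"
        unfolding sum_distrib_left sum_distrib_right sum.distrib[symmetric]
        by (intro sum.cong refl scale)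
      then show ?thesis
        unfolding scale[of "a t" "L t" "s t"] E_def N_def by (simp only: distrib_left distrib_right ac_simps)
    qed
    also have "\<dots> = (L t)\<^sup>2 * M t - N t"
      by (simp add: M_def algebra_simps)
    also have "\<dots> = 0"
      using pos[OF t] by (simp add: L_def)
    finally show ?thesis .
  qed
  moreover have "L 0 = 1" "0 < \<eta>" "\<eta> \<le> \<epsilon>"
    using N0 M0 r(1) \<open>0 < \<epsilon>\<close> by (auto simp: L_def \<eta>_def)
  ultimately show ?thesis
    using L_C1 L' by (intro exI[of _ \<eta>] exI[of _ L] conjI ballI)
qed

text \<open>The straight line \<open>x + t * d\<close> is corrected by
  \<open>radial_projection\<close> one layer at a time. A correction keeps the tangent
  \<open>d\<close> at 0, so the equality constraints of the next layer are again stationary there,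
  and it leaves those of earlier layers intact.\<close>

lemma feasible_arc:
  assumes wf: "bm_wf D" and npcq: "NPCQ D x" and feas: "bm_feasible D x"
    and d: "\<And>a. a \<in> eqs D \<Longrightarrow> dirder D (hcon D a) x d = 0"
  shows "\<exists>p \<epsilon>. 0 < \<epsilon> \<and> p 0 = x \<and> (\<forall>c. (\<lambda>t. p t c) C1_differentiable_on {0..<\<epsilon>}) \<and>
    (\<forall>c. ((\<lambda>t. p t c) has_real_derivative d c) (at 0)) \<and>
    (\<forall>a\<in>eqs D. \<forall>t\<in>{0..<\<epsilon>}. hcon D a (p t) = 0)"
proof -
  have "dirder D (hcon D H0) x d = 0"
    by (intro d) simp
  \<comment> \<open>With zero velocity in \<open>u\<^sub>0\<close> the arc can keep
    \<open>u\<^sub>0\<close> constant and satisfy \<open>H0\<close> exactly.\<close>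
  then have d_u0: "d Cu0 = 0"
    using feasible_u0(2)[OF feas] by (simp add: dirder_h0[OF wf])
  have arc: "\<exists>p \<epsilon>. 0 < \<epsilon> \<and> p 0 = x \<and> (\<forall>c. (\<lambda>t. p t c) C1_differentiable_on {0..<\<epsilon>}) \<and>
      (\<forall>c. ((\<lambda>t. p t c) has_real_derivative d c) (at 0)) \<and> (\<forall>t. p t Cu0 = x Cu0) \<and>
      (\<forall>k i. 1 \<le> k \<longrightarrow> k \<le> n \<longrightarrow> i < width D (k + 1) \<longrightarrow> (\<forall>t\<in>{0..<\<epsilon>}. hcon D (H k i) (p t) = 0))"
    if "n < depth D" for n
    using that
  proof (induction n)
    case 0
    show ?case
      by (rule exI[of _ "\<lambda>t c. x c + t * d c"], rule exI[of _ 1])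
        (auto simp: d_u0 intro!: derivative_eq_intros C1_differentiable_on_add C1_differentiable_on_mult)
  next
    case (Suc n)
    from Suc.IH Suc.prems obtain p \<epsilon> where "0 < \<epsilon>" and p0: "p 0 = x"
      and C1: "\<And>c. (\<lambda>t. p t c) C1_differentiable_on {0..<\<epsilon>}"
      and p': "\<And>c. ((\<lambda>t. p t c) has_real_derivative d c) (at 0)"
      and p_u0: "\<And>t. p t Cu0 = x Cu0"
      and p_h: "\<And>k i t. 1 \<le> k \<Longrightarrow> k \<le> n \<Longrightarrow> i < width D (k + 1) \<Longrightarrow> t \<in> {0..<\<epsilon>} \<Longrightarrow> hcon D (H k i) (p t) = 0"
      by (metis Suc_lessD)
    let ?k = "Suc n"
    have k: "1 \<le> ?k" "?k < depth D"
      using Suc.prems by auto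
    define a v where "a i t = pre_u D ?k i (p t)" and "v i j t = pre_V D ?k i j (p t)" for i j t
    define s q where "s i t = p t (Cu (?k + 1) i)" and "q i j t = p t (CV (?k + 1) i j)" for i j t
    define good where "good i \<eta> L \<longleftrightarrow> 0 < \<eta> \<and> \<eta> \<le> \<epsilon> \<and> L 0 = 1 \<and> (L has_real_derivative 0) (at 0) \<and>
        L C1_differentiable_on {0..<\<eta>} \<and>
        (\<forall>t\<in>{0..<\<eta>}. (a i t / 2 + L t * (s i t - a i t / 2) - a i t) * (a i t / 2 + L t * (s i t - a i t / 2))
          + (\<Sum>j<frank D - 1. (v i j t / 2 + L t * (q i j t - v i j t / 2) - v i j t)
              * (v i j t / 2 + L t * (q i j t - v i j t / 2))) = 0)" for i \<eta> L
    have C1_av: "a i C1_differentiable_on {0..<\<epsilon>}" "v i j C1_differentiable_on {0..<\<epsilon>}" for i j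
      unfolding a_def[abs_def] v_def[abs_def] pre_u_def pre_V_def
      by (intro C1_differentiable_on_add C1_differentiable_on_mult C1_differentiable_on_sum
          C1_differentiable_on_const C1)+
    have "\<exists>\<eta> L. good i \<eta> L" if i: "i < width D (?k + 1)" for i
      unfolding good_def
    proof (rule radial_projection)
      show "hcon D (H ?k i) (p t) = (s i t - a i t) * s i t + (\<Sum>j<frank D - 1. (q i j t - v i j t) * q i j t)" for t
        unfolding h_eq[OF wf k i] a_def v_def s_def q_def ..
      show "hcon D (H ?k i) (p 0) = 0"
        using feas k i by (simp add: p0 bm_feasible_def)
      \<comment> \<open>The arc built so far still has velocity \<open>d\<close> at 0, which the
        gradient of this constraint annihilates.\<close>
      have "((\<lambda>t. hcon D (H ?k i) (p t)) has_real_derivative dirder D (hcon D (H ?k i)) x d) (at 0)"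
        by (rule chain_rule[OF smooth_hcon[OF wf]]) (use k i p' in \<open>simp_all add: p0\<close>)
      then show "((\<lambda>t. hcon D (H ?k i) (p t)) has_real_derivative 0) (at 0)"
        using d[of "H ?k i"] k i by simp
      show "a i 0 \<noteq> 0"
        using NPCQ_D(1)[OF wf npcq k i] by (simp add: a_def p0)
      show "s i C1_differentiable_on {0..<\<epsilon>}" "q i j C1_differentiable_on {0..<\<epsilon>}" for j
        unfolding s_def[abs_def] q_def[abs_def] by (rule C1)+
    qed (use \<open>0 < \<epsilon>\<close> C1_av in auto)
    then obtain \<eta> L where good: "\<And>i. i < width D (?k + 1) \<Longrightarrow> good i (\<eta> i) (L i)"
      by metis
    define \<epsilon>' where "\<epsilon>' = Min (insert \<epsilon> (\<eta> ` {..<width D (?k + 1)}))"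
    have "0 < \<epsilon>'"
      using \<open>0 < \<epsilon>\<close> good by (auto simp: \<epsilon>'_def good_def)
    have sub: "{0..<\<epsilon>'} \<subseteq> {0..<\<epsilon>}" "\<And>i. i < width D (?k + 1) \<Longrightarrow> {0..<\<epsilon>'} \<subseteq> {0..<\<eta> i}"
      by (auto simp: \<epsilon>'_def)
    \<comment> \<open>The arc is to be C1 in every coordinate, so entries beyond the width, where no
      factor \<open>L i\<close> is available, keep their old value.\<close>
    define S Q where "S t i = (if i < width D (?k + 1) then a i t / 2 + L i t * (s i t - a i t / 2) else s i t)"
      and "Q t i j = (if i < width D (?k + 1) then v i j t / 2 + L i t * (q i j t - v i j t / 2) else q i j t)"
      for t i j
    define p' where "p' t = override_layer (?k + 1) (S t) (Q t) (p t)" for t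
    have C1_sub: "f C1_differentiable_on {0..<\<epsilon>'}" if "f C1_differentiable_on {0..<\<epsilon>}" for f :: "real \<Rightarrow> real"
      using that sub(1) by (rule C1_differentiable_on_subset)
    have C1_L: "L i C1_differentiable_on {0..<\<epsilon>'}" if "i < width D (?k + 1)" for i
      using good[OF that] sub(2)[OF that] unfolding good_def by (blast intro: C1_differentiable_on_subset)
    have blend_C1: "(\<lambda>t. f t / 2 + L i t * (p t c - f t / 2)) C1_differentiable_on {0..<\<epsilon>'}"
      if "f C1_differentiable_on {0..<\<epsilon>}" "i < width D (?k + 1)" for f i c
      unfolding divide_inverse
      by (intro C1_differentiable_on_add C1_differentiable_on_mult C1_differentiable_on_diff
          C1_differentiable_on_const C1_L C1_sub C1 that)
    have p'_C1: "(\<lambda>t. p' t c) C1_differentiable_on {0..<\<epsilon>'}" for c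
    proof (cases c)
      case (Cu m i)
      then show ?thesis
        using C1_sub[OF C1] blend_C1[OF C1_av(1)]
        by (cases "m = ?k + 1"; cases "i < width D (?k + 1)") (simp_all add: p'_def S_def s_def)
    next
      case (CV m i j)
      then show ?thesis
        using C1_sub[OF C1] blend_C1[OF C1_av(2)]
        by (cases "m = ?k + 1"; cases "i < width D (?k + 1)") (simp_all add: p'_def Q_def q_def)
    qed (simp add: p'_def C1_sub C1)
    \<comment> \<open>Since \<open>L i\<close> has value 1 and derivative 0 at 0, the motion of the
      centre \<open>f / 2\<close> cancels and the velocity \<open>d c\<close> survives.\<close>
    have blend_der: "((\<lambda>t. f t / 2 + L i t * (p t c - f t / 2)) has_real_derivative d c) (at 0)"
      if f: "f C1_differentiable_on {0..<\<epsilon>}" and i: "i < width D (?k + 1)" for f i c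
    proof -
      obtain f' where f': "(f has_real_derivative f') (at 0)"
        using C1_differentiable_on_has_derivative[OF f, of 0] \<open>0 < \<epsilon>\<close> by auto
      have "L i 0 = 1" "(L i has_real_derivative 0) (at 0)"
        using good[OF i] by (auto simp: good_def)
      then show ?thesis
        by (auto intro!: derivative_eq_intros f' p')
    qed
    have p'_der: "((\<lambda>t. p' t c) has_real_derivative d c) (at 0)" for c
    proof (cases c)
      case (Cu m i)
      then show ?thesis
        using p' blend_der[OF C1_av(1)]
        by (cases "m = ?k + 1"; cases "i < width D (?k + 1)") (simp_all add: p'_def S_def s_def)
    next
      case (CV m i j)
      then show ?thesis
        using p' blend_der[OF C1_av(2)]
        by (cases "m = ?k + 1"; cases "i < width D (?k + 1)") (simp_all add: p'_def Q_def q_def)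
    qed (simp add: p'_def p')
    have p'_0: "p' 0 = x"
    proof
      show "p' 0 c = x c" for c
        using good by (cases c) (simp_all add: p'_def S_def Q_def s_def q_def good_def p0)
    qed
    have "hcon D (H k i) (p' t) = 0"
      if ki: "1 \<le> k" "k \<le> ?k" "i < width D (k + 1)" and t: "t \<in> {0..<\<epsilon>'}" for k i t
    proof (cases "k = ?k")
      case True
      have i: "i < width D (?k + 1)"
        using ki True by simp
      have "pre_u D ?k i (p' t) = a i t" "\<And>j. pre_V D ?k i j (p' t) = v i j t"
        by (simp_all add: p'_def a_def v_def)
      then show ?thesis
        using good[OF i] t sub(2)[OF i] unfolding True h_eq[OF wf k i] good_def
        by (auto simp: p'_def S_def Q_def i[simplified] subset_iff)
    next
      case False
      then have k': "1 \<le> k" "k < depth D" "i < width D (k + 1)" "k \<le> n"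
        using ki k by auto
      have "hcon D (H k i) (p' t) = hcon D (H k i) (p t)"
        unfolding h_eq[OF wf k'(1-3)] using k'(4) by (simp add: p'_def)
      then show ?thesis
        using p_h[OF k'(1,4,3)] t sub(1) by auto
    qed
    then show ?case
      using \<open>0 < \<epsilon>'\<close> p'_0 p'_C1 p'_der p_u0
      by (intro exI[of _ p'] exI[of _ \<epsilon>']) (simp add: p'_def)
  qed
  have "depth D - 1 < depth D" "\<And>k. k < depth D \<Longrightarrow> k \<le> depth D - 1"
    using wf_dims(1)[OF wf] by auto
  with arc[of "depth D - 1"] obtain p \<epsilon> where p: "0 < \<epsilon>" "p 0 = x"
      "\<And>c. (\<lambda>t. p t c) C1_differentiable_on {0..<\<epsilon>}"
      "\<And>c. ((\<lambda>t. p t c) has_real_derivative d c) (at 0)" "\<And>t. p t Cu0 = x Cu0"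
      "\<And>k i t. 1 \<le> k \<Longrightarrow> k < depth D \<Longrightarrow> i < width D (k + 1) \<Longrightarrow> t \<in> {0..<\<epsilon>} \<Longrightarrow> hcon D (H k i) (p t) = 0"
    by metis
  have "hcon D a (p t) = 0" if "a \<in> eqs D" "t \<in> {0..<\<epsilon>}" for a t
    using that p(5,6) feasible_u0(1)[OF feas] by (cases a) (auto simp: h0_eq)
  with p(1-4) show ?thesis
    by (intro exI[of _ p] exI[of _ \<epsilon>]) blast
qed

text \<open>Strict decrease leaves room for the error between the arc and its tangent line. The arc
  meets the equalities exactly, and inactive inequalities persist by continuity.\<close>

lemma escape_path_if_descent_direction:
  assumes wf: "bm_wf D" and npcq: "NPCQ D x" and feas: "bm_feasible D x"
    and obj: "dirder D (obj D) x d < 0"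
    and g: "\<And>a. a \<in> ineqs D \<Longrightarrow> gcon D a x = 0 \<Longrightarrow> dirder D (gcon D a) x d < 0"
    and h: "\<And>a. a \<in> eqs D \<Longrightarrow> dirder D (hcon D a) x d = 0"
  shows "\<exists>p. escape_path D x p"
proof -
  from feasible_arc[OF wf npcq feas h] obtain p \<epsilon> where "0 < \<epsilon>" and p0: "p 0 = x"
    and C1: "\<And>c. (\<lambda>t. p t c) C1_differentiable_on {0..<\<epsilon>}"
    and p': "\<And>c. ((\<lambda>t. p t c) has_real_derivative d c) (at 0)"
    and p_h: "\<And>a t. a \<in> eqs D \<Longrightarrow> t \<in> {0..<\<epsilon>} \<Longrightarrow> hcon D a (p t) = 0"
    by (smt (verit))
  have der: "((\<lambda>t. F (p t)) has_real_derivative dirder D F x d) (at 0)" if "smooth_fun D F" for F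
    by (rule chain_rule[OF that]) (simp_all add: p0 p')
  \<comment> \<open>Half the slope: the derivative \<open>- 2 * \<delta>\<close> of the objective
    lies strictly below the rate \<open>- \<delta>\<close> demanded of the path.\<close>
  define \<delta> where "\<delta> = - dirder D (obj D) x d / 2"
  have "\<delta> > 0"
    using obj by (simp add: \<delta>_def)
  have "eventually (\<lambda>t. obj D (p t) \<le> obj D (p 0) + (- \<delta>) * t) (at_right 0)"
    using der[OF smooth_obj[OF wf]] \<open>\<delta> > 0\<close>
    by (intro eventually_linear_bound_if_derivative_less) (auto simp: \<delta>_def)
  moreover have "eventually (\<lambda>t. gcon D a (p t) \<le> 0) (at_right 0)" if a: "a \<in> ineqs D" for a
  proof (cases "gcon D a x = 0")
    case True
    from eventually_linear_bound_if_derivative_less[OF der[OF smooth_gcon[OF wf a]] g[OF a True]]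
    show ?thesis
      by (simp add: p0 True)
  next
    case False
    then have "gcon D a (p 0) < 0"
      using feas a by (simp add: p0 bm_feasible_def less_le)
    moreover have "((\<lambda>t. gcon D a (p t)) \<longlongrightarrow> gcon D a (p 0)) (at_right 0)"
      using DERIV_isCont[OF der[OF smooth_gcon[OF wf a]]] unfolding isCont_def
      by (rule tendsto_within_subset) simp
    ultimately have "eventually (\<lambda>t. gcon D a (p t) < 0) (at_right 0)"
      by (intro order_tendstoD)
    then show ?thesis
      by (rule eventually_mono) simp
  qed
  then have "eventually (\<lambda>t. \<forall>a\<in>ineqs D. gcon D a (p t) \<le> 0) (at_right 0)"
    by (intro eventually_ball_finite) auto
  ultimately have "eventually (\<lambda>t. obj D (p t) \<le> obj D (p 0) + (- \<delta>) * t \<and>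
      (\<forall>a\<in>ineqs D. gcon D a (p t) \<le> 0)) (at_right 0)"
    by (rule eventually_conj)
  then obtain r where r: "r > 0" "\<And>t. 0 < t \<Longrightarrow> t < r \<Longrightarrow>
      obj D (p t) \<le> obj D x - \<delta> * t \<and> (\<forall>a\<in>ineqs D. gcon D a (p t) \<le> 0)"
    unfolding eventually_at_right_field by (auto simp: p0)
  define \<eta> where "\<eta> = min r \<epsilon>"
  have "\<eta> > 0" and sub: "{0..<\<eta>} \<subseteq> {0..<\<epsilon>}"
    using r(1) \<open>0 < \<epsilon>\<close> by (auto simp: \<eta>_def)
  have "obj D (p t) \<le> obj D x - \<delta> * t \<and> bm_feasible D (p t)" if t: "t \<in> {0..<\<eta>}" for t
  \<comment> \<open>The filter \<open>at_right 0\<close> does not see \<open>t = 0\<close>; there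
    the feasibility of \<open>x\<close> itself is used.\<close>
  proof (cases "t = 0")
    case True
    then show ?thesis
      using feas by (simp add: p0)
  next
    case False
    then show ?thesis
      using r(2)[of t] p_h[of _ t] t by (simp add: \<eta>_def bm_feasible_def)
  qed
  moreover have "C1_path D \<eta> p"
    unfolding C1_path_def
  proof
    fix c assume "c \<in> coords D"
    obtain p' where "continuous_on {0..<\<eta>} p'"
      "\<And>t. t \<in> {0..<\<eta>} \<Longrightarrow> ((\<lambda>s. p s c) has_real_derivative p' t) (at t)"
      using C1_differentiable_on_subset[OF C1 sub, of c]
      unfolding C1_differentiable_on_def has_real_derivative_iff_has_vector_derivative by blast
    then show "\<exists>p'. continuous_on {0..<\<eta>} p' \<and>
        (\<forall>t\<in>{0..<\<eta>}. ((\<lambda>s. p s c) has_real_derivative p' t) (at t within {0..<\<eta>}))"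
      using has_field_derivative_at_within by blast
  qed
  ultimately have "escape_path D x p"
    unfolding escape_path_def using \<open>\<delta> > 0\<close> \<open>\<eta> > 0\<close> p0 by blast
  then show ?thesis
    by blast
qed

section \<open>Multipliers: sufficiency, uniqueness, existence\<close>

lemma sum_mult_dirder:
  "(\<Sum>a\<in>A. w a * dirder D (F a) x d) = (\<Sum>c\<in>coords D. (\<Sum>a\<in>A. grad (F a) x c * w a) * d c)"
  unfolding dirder_def sum_distrib_left sum_distrib_right
  by (subst sum.swap) (simp add: mult_ac)

lemma stationary_dirder:
  assumes "\<And>c. c \<in> coords D \<Longrightarrow> grad (obj D) x c + (\<Sum>a\<in>ineqs D. grad (gcon D a) x c * y a)
      + (\<Sum>a\<in>eqs D. grad (hcon D a) x c * z a) = 0"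
  shows "dirder D (obj D) x d + (\<Sum>a\<in>ineqs D. y a * dirder D (gcon D a) x d)
    + (\<Sum>a\<in>eqs D. z a * dirder D (hcon D a) x d) = 0"
proof -
  have "dirder D (obj D) x d + (\<Sum>a\<in>ineqs D. y a * dirder D (gcon D a) x d)
      + (\<Sum>a\<in>eqs D. z a * dirder D (hcon D a) x d)
    = (\<Sum>c\<in>coords D. (grad (obj D) x c + (\<Sum>a\<in>ineqs D. grad (gcon D a) x c * y a)
        + (\<Sum>a\<in>eqs D. grad (hcon D a) x c * z a)) * d c)"
    unfolding sum_mult_dirder distrib_right sum.distrib by (simp add: dirder_def)
  also have "\<dots> = 0"
    using assms by simp
  finally show ?thesis .
qed

lemma certifies_stationary:
  assumes "certifies D x y z"
  shows "dirder D (obj D) x d + (\<Sum>a\<in>ineqs D. y a * dirder D (gcon D a) x d)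
    + (\<Sum>a\<in>eqs D. z a * dirder D (hcon D a) x d) = 0"
  by (rule stationary_dirder) (use assms in \<open>simp add: certifies_def\<close>)

text \<open>Pair stationarity with the initial velocity of the path. The objective contributes at
  most \<open>- \<delta>\<close>, active inequalities at most 0 since \<open>y\<close> is
  nonnegative, inactive ones 0 by complementary slackness, and equalities 0, so the sum cannot
  vanish.\<close>

lemma no_escape_path_if_certified:
  assumes wf: "bm_wf D" and cert: "certifies D x y z"
  shows "\<not> escape_path D x p"
proof
  assume "escape_path D x p"
  then obtain \<delta> \<epsilon> where p0: "\<And>c. c \<in> coords D \<Longrightarrow> p 0 c = x c" and "\<delta> > 0" "\<epsilon> > 0"
    and C1: "C1_path D \<epsilon> p"
    and obj: "\<And>t. t \<in> {0..<\<epsilon>} \<Longrightarrow> obj D (p t) \<le> obj D x - \<delta> * t"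
    and feas: "\<And>t. t \<in> {0..<\<epsilon>} \<Longrightarrow> bm_feasible D (p t)"
    unfolding escape_path_def by blast
  \<comment> \<open>Velocities are available on \<open>coords D\<close> only; the implication makes
    the choice of \<open>d\<close> total.\<close>
  have "\<exists>d. c \<in> coords D \<longrightarrow> ((\<lambda>s. p s c) has_real_derivative d) (at 0 within {0..<\<epsilon>})" for c
    using C1 \<open>\<epsilon> > 0\<close> unfolding C1_path_def by fastforce
  then obtain d where d: "\<And>c. c \<in> coords D \<Longrightarrow>
      ((\<lambda>s. p s c) has_real_derivative d c) (at 0 within {0..<\<epsilon>})"
    by metis
  have bound: "dirder D F x d \<le> m"
    if "smooth_fun D F" "\<And>t. t \<in> {0..<\<epsilon>} \<Longrightarrow> F (p t) \<le> F x + m * t" for F m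
  proof (rule derivative_le_if_linear_bound[OF _ \<open>\<epsilon> > 0\<close>])
    show "((\<lambda>t. F (p t)) has_real_derivative dirder D F x d) (at 0 within {0..<\<epsilon>})"
      by (rule chain_rule[OF that(1) p0 d])
    show "F (p t) \<le> F (p 0) + m * t" if "0 \<le> t" "t < \<epsilon>" for t
      using \<open>\<And>t. t \<in> {0..<\<epsilon>} \<Longrightarrow> F (p t) \<le> F x + m * t\<close>[of t] that
        smooth_fun_cong[OF \<open>smooth_fun D F\<close> p0] by simp
  qed
  have x_feas: "bm_feasible D x" and y: "\<And>a. a \<in> ineqs D \<Longrightarrow> 0 \<le> y a"
    "\<And>a. a \<in> ineqs D \<Longrightarrow> y a * gcon D a x = 0"
    using cert by (auto simp: certifies_def)
  have "dirder D (obj D) x d \<le> - \<delta>"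
    using obj by (intro bound[OF smooth_obj[OF wf]]) auto
  moreover have "(\<Sum>a\<in>ineqs D. y a * dirder D (gcon D a) x d) \<le> 0"
  proof (intro sum_nonpos)
    fix a assume a: "a \<in> ineqs D"
    show "y a * dirder D (gcon D a) x d \<le> 0"
    proof (cases "gcon D a x = 0")
      case True
      have "dirder D (gcon D a) x d \<le> 0"
        using feas a True by (intro bound[OF smooth_gcon[OF wf a]]) (auto simp: bm_feasible_def)
      then show ?thesis
        using y(1)[OF a] by (simp add: mult_nonneg_nonpos)
    next
      case False
      then show ?thesis
        using y(2)[OF a] by simp
    qed
  qed
  moreover have "(\<Sum>a\<in>eqs D. z a * dirder D (hcon D a) x d) = 0"
  proof (intro sum.neutral ballI)
    fix a assume a: "a \<in> eqs D"
    have der: "((\<lambda>t. hcon D a (p t)) has_real_derivative dirder D (hcon D a) x d) (at 0 within {0..<\<epsilon>})"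
      by (rule chain_rule[OF smooth_hcon[OF wf a] p0 d])
    have zero: "hcon D a (p t) = 0" if "0 \<le> t" "t < \<epsilon>" for t
      using feas[of t] a that by (simp add: bm_feasible_def)
    \<comment> \<open>A function vanishing along the path obeys the linear bound with slope 0, and
      so does its negative.\<close>
    have "dirder D (hcon D a) x d \<le> 0" "- dirder D (hcon D a) x d \<le> 0"
      using derivative_le_if_linear_bound[OF der \<open>\<epsilon> > 0\<close>, of 0]
        derivative_le_if_linear_bound[OF DERIV_minus[OF der] \<open>\<epsilon> > 0\<close>, of 0] zero \<open>\<epsilon> > 0\<close>
      by simp_all
    then show "z a * dirder D (hcon D a) x d = 0"
      by simp
  qed
  ultimately show False
    using certifies_stationary[OF cert, of d] \<open>\<delta> > 0\<close> by simp
qed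

text \<open>The difference of two certificates is orthogonal to all values that the linearised
  constraints attain. By \<open>linearisation_surj\<close> these are arbitrary, and unit vectors
  isolate each multiplier.\<close>

lemma certificate_unique:
  assumes wf: "bm_wf D" and npcq: "NPCQ D x"
    and cert: "certifies D x y z" "certifies D x y' z'"
  shows "\<And>a. a \<in> ineqs D \<Longrightarrow> y a = y' a" "\<And>a. a \<in> eqs D \<Longrightarrow> z a = z' a"
proof -
  have feas: "bm_feasible D x" and
    slack: "\<And>a. a \<in> ineqs D \<Longrightarrow> y a * gcon D a x = 0" "\<And>a. a \<in> ineqs D \<Longrightarrow> y' a * gcon D a x = 0"
    using cert by (auto simp: certifies_def)
  have pairing: "(\<Sum>a\<in>ineqs D. (y a - y' a) * \<beta> a) + (\<Sum>a\<in>eqs D. (z a - z' a) * \<gamma> a) = 0" for \<beta> \<gamma>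
  proof -
    obtain d where d: "\<And>a. a \<in> ineqs D \<Longrightarrow> gcon D a x = 0 \<Longrightarrow> dirder D (gcon D a) x d = \<beta> a"
      "\<And>a. a \<in> eqs D \<Longrightarrow> dirder D (hcon D a) x d = \<gamma> a"
      using linearisation_surj[OF wf npcq feas, of \<beta> \<gamma>] by blast
    \<comment> \<open>For an inactive inequality \<open>d\<close> has no prescribed rate, but there
      both multipliers vanish.\<close>
    have "(\<Sum>a\<in>ineqs D. (y a - y' a) * \<beta> a) = (\<Sum>a\<in>ineqs D. (y a - y' a) * dirder D (gcon D a) x d)"
      using slack d(1) by (intro sum.cong refl) (metis diff_self mult_eq_0_iff)
    moreover have "(\<Sum>a\<in>eqs D. (z a - z' a) * \<gamma> a) = (\<Sum>a\<in>eqs D. (z a - z' a) * dirder D (hcon D a) x d)"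
      using d(2) by (intro sum.cong refl) simp
    ultimately show ?thesis
      using cert[THEN certifies_stationary, of d] by (simp add: left_diff_distrib sum_subtractf)
  qed
  have sgl: "(\<Sum>b\<in>B. w b * (if b = a then 1 else 0)) = w a" if "finite B" "a \<in> B"
    for B :: "'i set" and w :: "'i \<Rightarrow> real" and a
    using that by (simp add: if_distrib[of "\<lambda>a. _ * a"] cong: if_cong)
  show "y a = y' a" if "a \<in> ineqs D" for a
    using pairing[of "\<lambda>b. if b = a then 1 else 0" "\<lambda>_. 0"] sgl[OF finite_ineqs that, of "\<lambda>b. y b - y' b"]
    by simp
  show "z a = z' a" if "a \<in> eqs D" for a
    using pairing[of "\<lambda>_. 0" "\<lambda>b. if b = a then 1 else 0"] sgl[OF finite_eqs that, of "\<lambda>b. z b - z' b"]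
    by simp
qed

text \<open>A descent direction would yield an escape path, so the linear alternative puts the
  gradient of the objective in the span of the active gradients; the negated coefficients are the
  multipliers. A negative multiplier would again create a descent direction.\<close>

lemma certificate_if_no_escape_path:
  assumes wf: "bm_wf D" and npcq: "NPCQ D x" and opt: "first_order_optimal D x"
  shows "\<exists>y z. certifies D x y z"
proof -
  have feas: "bm_feasible D x" and no_escape: "\<not> (\<exists>p. escape_path D x p)"
    using opt by (auto simp: first_order_optimal_def)
  define A where "A = {a \<in> ineqs D. gcon D a x = 0}"
  have "finite A"
    by (simp add: A_def)
  \<comment> \<open>The disjoint sum makes one family of rows out of active inequalities and
    equalities.\<close>
  define G where "G = case_sum (\<lambda>a. grad (gcon D a) x) (\<lambda>a. grad (hcon D a) x)"
  have G: "(\<Sum>c\<in>coords D. G (Inl a) c * d c) = dirder D (gcon D a) x d"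
    "(\<Sum>c\<in>coords D. G (Inr b) c * d c) = dirder D (hcon D b) x d" for a b d
    by (simp_all add: G_def dirder_def)
  have surj: "\<exists>d. \<forall>a\<in>A <+> eqs D. (\<Sum>c\<in>coords D. G a c * d c) = \<beta> a" for \<beta>
  proof -
    obtain d where "\<forall>a\<in>ineqs D. gcon D a x = 0 \<longrightarrow> dirder D (gcon D a) x d = \<beta> (Inl a)"
      "\<forall>a\<in>eqs D. dirder D (hcon D a) x d = \<beta> (Inr a)"
      using linearisation_surj[OF wf npcq feas, of "\<beta> \<circ> Inl" "\<beta> \<circ> Inr"] by auto
    then show ?thesis
      by (intro exI[of _ d]) (auto simp: G A_def)
  qed
  have no_descent: "\<not> dirder D (obj D) x d < 0"
    if "\<And>a. a \<in> A \<Longrightarrow> dirder D (gcon D a) x d < 0" "\<And>a. a \<in> eqs D \<Longrightarrow> dirder D (hcon D a) x d = 0" for d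
    using escape_path_if_descent_direction[OF wf npcq feas, of d] no_escape that by (auto simp: A_def)
  have "\<not> (\<forall>\<beta>. \<exists>d. (\<forall>a\<in>A <+> eqs D. (\<Sum>c\<in>coords D. G a c * d c) = \<beta> a) \<and>
      (\<Sum>c\<in>coords D. grad (obj D) x c * d c) < 0)"
  proof
    assume "\<forall>\<beta>. \<exists>d. (\<forall>a\<in>A <+> eqs D. (\<Sum>c\<in>coords D. G a c * d c) = \<beta> a) \<and>
      (\<Sum>c\<in>coords D. grad (obj D) x c * d c) < 0"
    \<comment> \<open>Rate -1 on active inequalities and 0 on equalities meets the conditions of
      \<open>no_descent\<close>.\<close>
    from this[rule_format, of "case_sum (\<lambda>_. - 1) (\<lambda>_. 0)"]
    obtain d where d: "\<And>a. a \<in> A <+> eqs D \<Longrightarrow> (\<Sum>c\<in>coords D. G a c * d c) = case_sum (\<lambda>_. - 1) (\<lambda>_. 0) a"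
      "dirder D (obj D) x d < 0"
      unfolding dirder_def by blast
    then show False
      using no_descent[of d] d(1)[OF InlI] d(1)[OF InrI] d(2) by (simp add: G)
  qed
  then obtain \<mu> where \<mu>: "\<And>c. c \<in> coords D \<Longrightarrow> grad (obj D) x c = (\<Sum>a\<in>A <+> eqs D. \<mu> a * G a c)"
    using span_or_descent_direction[OF finite_coords finite_Plus[OF \<open>finite A\<close> finite_eqs] surj,
        of "grad (obj D) x"] by blast
  \<comment> \<open>The value 0 off \<open>A\<close> provides complementary slackness.\<close>
  define y where "y a = (if a \<in> A then - \<mu> (Inl a) else 0)" for a
  define z where "z a = - \<mu> (Inr a)" for a
  have stat: "grad (obj D) x c + (\<Sum>a\<in>ineqs D. grad (gcon D a) x c * y a)
      + (\<Sum>a\<in>eqs D. grad (hcon D a) x c * z a) = 0" if "c \<in> coords D" for c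
  proof -
    have "(\<Sum>a\<in>ineqs D. grad (gcon D a) x c * y a) = (\<Sum>a\<in>A. grad (gcon D a) x c * - \<mu> (Inl a))"
      by (rule sum.mono_neutral_cong_right) (auto simp: A_def y_def)
    then show ?thesis
      using \<mu>[OF that] \<open>finite A\<close> by (simp add: sum.Plus z_def G_def sum_negf mult_ac)
  qed
  have obj_dirder: "dirder D (obj D) x d
      = - (\<Sum>a\<in>A. y a * dirder D (gcon D a) x d) - (\<Sum>a\<in>eqs D. z a * dirder D (hcon D a) x d)" for d
  proof -
    have "(\<Sum>a\<in>ineqs D. y a * dirder D (gcon D a) x d) = (\<Sum>a\<in>A. y a * dirder D (gcon D a) x d)"
      by (rule sum.mono_neutral_right) (auto simp: A_def y_def)
    then show ?thesis
      using stationary_dirder[OF stat, of d] by linarith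
  qed
  have "0 \<le> y b" if "b \<in> A" for b
  proof (rule ccontr)
    assume "\<not> 0 \<le> y b"
    \<comment> \<open>Decreasing constraint \<open>b\<close> fast enough outweighs the contribution of the others to the objective.\<close>
    define \<tau> where "\<tau> a = 1 + (if a = b then (\<bar>\<Sum>a\<in>A. y a\<bar> + 1) / (- y b) else 0)" for a
    obtain d where d: "\<And>a. a \<in> A <+> eqs D \<Longrightarrow>
        (\<Sum>c\<in>coords D. G a c * d c) = case_sum (\<lambda>a. - \<tau> a) (\<lambda>_. 0) a"
      using surj[of "case_sum (\<lambda>a. - \<tau> a) (\<lambda>_. 0)"] by blast
    have g: "dirder D (gcon D a) x d = - \<tau> a" if "a \<in> A" for a
      using d[OF InlI[OF that]] by (simp add: G)
    have h: "dirder D (hcon D a) x d = 0" if "a \<in> eqs D" for a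
      using d[OF InrI[OF that]] by (simp add: G)
    have "\<tau> a > 0" for a
      using \<open>\<not> 0 \<le> y b\<close> by (auto simp: \<tau>_def intro!: add_pos_nonneg divide_nonneg_neg divide_nonneg_pos)
    moreover have "dirder D (obj D) x d < 0"
    proof -
      have "dirder D (obj D) x d = (\<Sum>a\<in>A. y a * \<tau> a)"
        by (simp add: obj_dirder g h sum_negf)
      also have "\<dots> = (\<Sum>a\<in>A. y a) + y b * ((\<bar>\<Sum>a\<in>A. y a\<bar> + 1) / (- y b))"
        using \<open>finite A\<close> \<open>b \<in> A\<close>
        by (simp add: \<tau>_def distrib_left sum.distrib if_distrib[of "\<lambda>a. _ * a"] cong: if_cong)
      also have "\<dots> = (\<Sum>a\<in>A. y a) - (\<bar>\<Sum>a\<in>A. y a\<bar> + 1)"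
        using \<open>\<not> 0 \<le> y b\<close> by simp
      finally show ?thesis
        by linarith
    qed
    ultimately show False
      using no_descent[of d] g h by simp
  qed
  then have "certifies D x y z"
    unfolding certifies_def using feas stat by (auto simp: y_def A_def)
  then show ?thesis
    by blast
qed

theorem lemma4p2:
  fixes D :: bm_data and x :: point
  assumes "bm_wf D"
    and "NPCQ D x"
  shows "(first_order_optimal D x \<longleftrightarrow> (\<exists>y z. certifies D x y z)) \<and>
         (\<forall>y z y' z'. certifies D x y z \<and> certifies D x y' z' \<longrightarrow>
            (\<forall>a\<in>ineqs D. y a = y' a) \<and> (\<forall>a\<in>eqs D. z a = z' a))"
proof (intro conjI iffI allI impI ballI)
  show "\<exists>y z. certifies D x y z" if "first_order_optimal D x"
    using certificate_if_no_escape_path[OF assms that] .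
  show "first_order_optimal D x" if "\<exists>y z. certifies D x y z"
    using that no_escape_path_if_certified[OF assms(1)]
    unfolding first_order_optimal_def by (metis certifies_def)
qed (use certificate_unique[OF assms] in blast)+

end
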